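(* Let $\mathbb{K}$ be an algebraically closed subfield of $\mathbb{C}$ and let $\mathbb{A}$ be a medial generic isospectral algebra over $\mathbb{K}$ of dimension $n\ge 2$, with $\mathrm{Idm}(\mathbb{A})$ its set of nonzero idempotents. Then there exists a bijection $\phi:\mathrm{Idm}(\mathbb{A})\to\mathbb{Z}_{2^n-1}$ such that $$\phi(xy)\equiv \tfrac12\big(\phi(x)+\phi(y)\big)\mod 2^n-1\qquad\text{for all }x,y\in\mathrm{Idm}(\mathbb{A}).$$
   Context: All algebras are commutative, finite-dimensional. Medial: $(xy)(zw)=(xz)(yw)$ for all $x,y,z,w$. Isospectral: all nonzero idempotents $c$ have the same spectrum (multiset of eigenvalues of $L_c:x\mapsto cx$). Generic (over a subfield of $\mathbb{C}$, dimension $n$): the complexification has exactly $2^n$ distinct idempotents (including $0$). Here $\frac12$ denotes the inverse of $2$ in $\mathbb{Z}_{2^n-1}$. *)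

theory Defs
  imports "Jordan_Normal_Form.Char_Poly" "HOL-Computational_Algebra.Polynomial_Factorial"
    "HOL-Number_Theory.Cong"
begin

definition subfield_of_C :: "complex set \<Rightarrow> bool" where
  "subfield_of_C K \<longleftrightarrow> 0 \<in> K \<and> 1 \<in> K \<and>
     (\<forall>a\<in>K. \<forall>b\<in>K. a + b \<in> K \<and> a * b \<in> K \<and> a - b \<in> K) \<and>
     (\<forall>a\<in>K. a \<noteq> 0 \<longrightarrow> inverse a \<in> K)"

definition alg_closed_subfield :: "complex set \<Rightarrow> bool" where
  "alg_closed_subfield K \<longleftrightarrow> subfield_of_C K \<and>
     (\<forall>p :: complex poly. (\<forall>i. coeff p i \<in> K) \<longrightarrow> degree p \<ge> 1 \<longrightarrow>
        (\<exists>x\<in>K. poly p x = 0))"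

(* An n-dimensional commutative algebra over K is given by structure constants
   C i j k \<in> K (e_i e_j = \<Sum>k. C i j k e_k), C i j k = C j i k.
   The same structure constants define its complexification on \<complex>^n. *)
definition mul :: "nat \<Rightarrow> (nat \<Rightarrow> nat \<Rightarrow> nat \<Rightarrow> complex) \<Rightarrow> complex vec \<Rightarrow> complex vec \<Rightarrow> complex vec" where
  "mul n C x y = vec n (\<lambda>k. \<Sum>i<n. \<Sum>j<n. x $ i * y $ j * C i j k)"

definition comm_struct :: "complex set \<Rightarrow> nat \<Rightarrow> (nat \<Rightarrow> nat \<Rightarrow> nat \<Rightarrow> complex) \<Rightarrow> bool" where
  "comm_struct K n C \<longleftrightarrow> (\<forall>i<n. \<forall>j<n. \<forall>k<n. C i j k \<in> K \<and> C i j k = C j i k)"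

(* underlying K-vector space of the algebra: K^n inside \<complex>^n *)
definition Kvecs :: "complex set \<Rightarrow> nat \<Rightarrow> complex vec set" where
  "Kvecs K n = {x \<in> carrier_vec n. \<forall>i<n. x $ i \<in> K}"

definition medial :: "complex set \<Rightarrow> nat \<Rightarrow> (nat \<Rightarrow> nat \<Rightarrow> nat \<Rightarrow> complex) \<Rightarrow> bool" where
  "medial K n C \<longleftrightarrow> (\<forall>x\<in>Kvecs K n. \<forall>y\<in>Kvecs K n. \<forall>z\<in>Kvecs K n. \<forall>w\<in>Kvecs K n.
      mul n C (mul n C x y) (mul n C z w) = mul n C (mul n C x z) (mul n C y w))"

definition Idm :: "complex set \<Rightarrow> nat \<Rightarrow> (nat \<Rightarrow> nat \<Rightarrow> nat \<Rightarrow> complex) \<Rightarrow> complex vec set" where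
  "Idm K n C = {c \<in> Kvecs K n. mul n C c c = c \<and> c \<noteq> 0\<^sub>v n}"

(* generic: the complexification has exactly 2^n idempotents (including 0) *)
definition generic :: "nat \<Rightarrow> (nat \<Rightarrow> nat \<Rightarrow> nat \<Rightarrow> complex) \<Rightarrow> bool" where
  "generic n C \<longleftrightarrow> finite {c \<in> carrier_vec n. mul n C c c = c} \<and>
                   card {c \<in> carrier_vec n. mul n C c c = c} = 2 ^ n"

definition Lmat :: "nat \<Rightarrow> (nat \<Rightarrow> nat \<Rightarrow> nat \<Rightarrow> complex) \<Rightarrow> complex vec \<Rightarrow> complex mat" where
  "Lmat n C c = mat n n (\<lambda>(k, j). \<Sum>i<n. c $ i * C i j k)"

definition spectrum_L :: "nat \<Rightarrow> (nat \<Rightarrow> nat \<Rightarrow> nat \<Rightarrow> complex) \<Rightarrow> complex vec \<Rightarrow> complex multiset" where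
  "spectrum_L n C c = proots (char_poly (Lmat n C c))"

definition isospectral :: "complex set \<Rightarrow> nat \<Rightarrow> (nat \<Rightarrow> nat \<Rightarrow> nat \<Rightarrow> complex) \<Rightarrow> bool" where
  "isospectral K n C \<longleftrightarrow> (\<forall>c\<in>Idm K n C. \<forall>d\<in>Idm K n C. spectrum_L n C c = spectrum_L n C d)"

(* 1/2 : the inverse of 2 in Z_m (m odd) *)
definition half_mod :: "int \<Rightarrow> int" where
  "half_mod m = (SOME h. 0 \<le> h \<and> h < m \<and> [2 * h = 1] (mod m))"

end

theory Submission
  imports Defs "Jordan_Normal_Form.Jordan_Normal_Form_Existence"
    "Jordan_Normal_Form.Jordan_Normal_Form_Uniqueness" "HOL-Library.Function_Algebras"
begin

text \<open>Since there are only finitely many complex idempotents, all of them have coordinates in the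
  algebraically closed field \<open>K\<close>, so \<open>G = Idm K n C\<close> has \<open>2^n - 1\<close> elements.

  For an idempotent \<open>c\<close> let \<open>N c\<close> be the space of vectors killed by a power of \<open>L\<^sub>c\<close>. Mediality gives
  \<open>N d \<subseteq> N (c d)\<close>, and isospectrality makes all \<open>N c\<close> equidimensional. If \<open>c d = 0\<close>, then \<open>c + d\<close> is an
  idempotent with \<open>N (c + d) \<subseteq> N c \<inter> N d\<close>, so \<open>d \<in> N c = N d\<close>, which is absurd. Hence \<open>G\<close> is closed under
  multiplication and \<open>N c\<close> does not depend on \<open>c\<close>, from which \<open>G\<close> is seen to be cancellative.

  A finite commutative idempotent medial quasigroup carries an abelian group structure with
  \<open>x y = (x + y) / 2\<close>. The restrictions of linear functionals to \<open>G\<close> form a translation invariant space of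
  dimension at most \<open>n\<close>, so they contain at most \<open>n\<close> characters, and these separate the points of \<open>G\<close>.
  The set of these characters is stable under squaring. A character on a squaring cycle of length \<open>l\<close>
  takes values in the \<open>(2^l - 1)\<close>-th roots of unity and determines the other characters of its cycle;
  as \<open>G\<close> has \<open>2^n - 1\<close> elements, there can only be one cycle, of length \<open>n\<close>. Any character is therefore
  injective, and \<open>\<phi>\<close> is its discrete logarithm.\<close>

section \<open>Finitely many zeros lie over the algebraically closed base field\<close>

definition polys_over :: "complex set \<Rightarrow> complex poly set" where
  "polys_over S = {p. \<forall>i. coeff p i \<in> S}"

definition adjoin :: "complex set \<Rightarrow> complex \<Rightarrow> complex set" where
  "adjoin S c = (\<lambda>p. poly p c) ` polys_over S"

text \<open>Only the values of \<open>h\<close> on \<open>S\<close> matter. Fixing \<open>K\<close>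
  pointwise makes \<open>h\<close> unital and \<open>K\<close>-linear there, so it carries solutions
  in \<open>S\<close> of polynomial equations over \<open>K\<close> to solutions in
  \<open>K\<close>.\<close>

definition K_hom :: "complex set \<Rightarrow> complex set \<Rightarrow> (complex \<Rightarrow> complex) \<Rightarrow> bool" where
  "K_hom K S h \<longleftrightarrow> h ` S \<subseteq> K \<and> (\<forall>k\<in>K. h k = k) \<and>
     (\<forall>a\<in>S. \<forall>b\<in>S. h (a + b) = h a + h b \<and> h (a * b) = h a * h b)"

locale subalgebra_of_C =
  fixes K S :: "complex set"
  assumes K: "subfield_of_C K" and KS: "K \<subseteq> S"
    and add_closed: "a \<in> S \<Longrightarrow> b \<in> S \<Longrightarrow> a + b \<in> S"
    and mult_closed: "a \<in> S \<Longrightarrow> b \<in> S \<Longrightarrow> a * b \<in> S"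
begin

lemma zero_closed: "0 \<in> S" and one_closed: "1 \<in> S"
  using K KS by (auto simp: subfield_of_C_def)

lemma uminus_closed: "a \<in> S \<Longrightarrow> - a \<in> S"
proof -
  have "0 - 1 \<in> K" using K unfolding subfield_of_C_def by blast
  then show "a \<in> S \<Longrightarrow> - a \<in> S" using KS mult_closed[of "-1" a] by auto
qed

lemma diff_closed: "a \<in> S \<Longrightarrow> b \<in> S \<Longrightarrow> a - b \<in> S"
  using add_closed[of a "- b"] uminus_closed by simp

lemma sum_closed: "(\<And>i. i \<in> A \<Longrightarrow> f i \<in> S) \<Longrightarrow> sum f A \<in> S"
  by (induction A rule: infinite_finite_induct) (auto intro: add_closed zero_closed)

lemma prod_closed: "(\<And>i. i \<in> A \<Longrightarrow> f i \<in> S) \<Longrightarrow> prod f A \<in> S"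
  by (induction A rule: infinite_finite_induct) (auto intro: mult_closed one_closed)

lemma power_closed: "a \<in> S \<Longrightarrow> a ^ m \<in> S"
  by (induction m) (auto intro: mult_closed one_closed)

lemma polys_add: "p \<in> polys_over S \<Longrightarrow> q \<in> polys_over S \<Longrightarrow> p + q \<in> polys_over S"
  and polys_diff: "p \<in> polys_over S \<Longrightarrow> q \<in> polys_over S \<Longrightarrow> p - q \<in> polys_over S"
  and polys_smult: "a \<in> S \<Longrightarrow> p \<in> polys_over S \<Longrightarrow> Polynomial.smult a p \<in> polys_over S"
  and polys_monom: "a \<in> S \<Longrightarrow> Polynomial.monom a m \<in> polys_over S"
  and polys_mult: "p \<in> polys_over S \<Longrightarrow> q \<in> polys_over S \<Longrightarrow> p * q \<in> polys_over S"
  and polys_zero: "0 \<in> polys_over S" and polys_one: "1 \<in> polys_over S"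
  by (auto simp: polys_over_def coeff_mult zero_closed one_closed coeff_1
      intro!: add_closed diff_closed mult_closed sum_closed)

lemma adjoin_superset: "S \<subseteq> adjoin S c" and adjoin_generator: "c \<in> adjoin S c"
proof -
  have "poly [:a:] c \<in> adjoin S c" if "a \<in> S" for a
    using that by (auto simp: adjoin_def polys_over_def coeff_pCons zero_closed split: nat.splits
        intro!: image_eqI[of _ _ "[:a:]"])
  then show "S \<subseteq> adjoin S c" by auto
  have "poly (Polynomial.monom 1 1) c \<in> adjoin S c"
    unfolding adjoin_def by (intro imageI polys_monom one_closed)
  then show "c \<in> adjoin S c" by (simp add: poly_monom)
qed

lemma subalgebra_adjoin: "subalgebra_of_C K (adjoin S c)"
proof
  show "K \<subseteq> adjoin S c" using KS adjoin_superset by blast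
  fix a b assume "a \<in> adjoin S c" "b \<in> adjoin S c"
  then obtain p q where pq: "p \<in> polys_over S" "q \<in> polys_over S" "a = poly p c" "b = poly q c"
    by (auto simp: adjoin_def)
  show "a + b \<in> adjoin S c" unfolding adjoin_def
    by (rule image_eqI[of _ _ "p + q"]) (use pq polys_add in auto)
  show "a * b \<in> adjoin S c" unfolding adjoin_def
    by (rule image_eqI[of _ _ "p * q"]) (use pq polys_mult in auto)
qed (rule K)

text \<open>The ring \<open>S\<close> need not be a field, so each cancellation of a leading term
  multiplies by \<open>lead_coeff p\<close> instead of dividing by it.\<close>

lemma pseudo_division:
  assumes p: "p \<in> polys_over S" "p \<noteq> 0" and r: "r \<in> polys_over S"
  shows "\<exists>m s t. s \<in> polys_over S \<and> t \<in> polys_over S \<and>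
           Polynomial.smult (lead_coeff p ^ m) r = p * s + t \<and> (t = 0 \<or> degree t < degree p)"
  using r
proof (induction "degree r" arbitrary: r rule: less_induct)
  case less
  show ?case
  proof (cases "r = 0 \<or> degree r < degree p")
    case True
    then show ?thesis
      using less.prems polys_zero by (intro exI[of _ "0::nat"] exI[of _ 0] exI[of _ r]) auto
  next
    case False
    define M where "M = Polynomial.monom (lead_coeff r) (degree r - degree p)"
    define r' where "r' = Polynomial.smult (lead_coeff p) r - p * M"
    have lc: "lead_coeff p \<in> S" using p by (auto simp: polys_over_def)
    have M: "M \<in> polys_over S"
      using less.prems unfolding M_def by (intro polys_monom) (auto simp: polys_over_def)
    have r': "r' \<in> polys_over S"
      unfolding r'_def by (intro polys_diff polys_smult polys_mult lc less.prems p M)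
    have M': "degree M = degree r - degree p" "lead_coeff M = lead_coeff r" "M \<noteq> 0"
      using False by (simp_all add: M_def degree_monom_eq)
    then have "degree (p * M) = degree r"
      using False p by (simp add: degree_mult_eq)
    then have "degree r' \<le> degree r"
      unfolding r'_def by (intro degree_diff_le) auto
    moreover have "coeff (p * M) (degree r) = lead_coeff p * lead_coeff r"
      using \<open>degree (p * M) = degree r\<close> lead_coeff_mult[of p M] M' by simp
    then have "coeff r' (degree r) = 0" by (simp add: r'_def)
    ultimately consider "r' = 0" | "degree r' < degree r"
      using eq_zero_or_degree_less by blast
    then obtain m s t where mst: "s \<in> polys_over S" "t \<in> polys_over S"
      "Polynomial.smult (lead_coeff p ^ m) r' = p * s + t" "t = 0 \<or> degree t < degree p"
    proof cases
      case 1
      then show ?thesis using that[of 0 0 0] polys_zero by auto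
    next
      case 2
      then show ?thesis using less.hyps[OF 2 r'] that by blast
    qed
    have "Polynomial.smult (lead_coeff p ^ Suc m) r = p * (s + Polynomial.smult (lead_coeff p ^ m) M) + t"
      using mst(3) by (simp add: r'_def smult_diff_right algebra_simps)
    then show ?thesis
      using mst M lc by (intro exI[of _ "Suc m"] exI[of _ "s + Polynomial.smult (lead_coeff p ^ m) M"] exI[of _ t])
        (auto intro!: polys_add polys_smult power_closed)
  qed
qed

context
  fixes h
  assumes h: "K_hom K S h"
begin

lemma hom_in: "a \<in> S \<Longrightarrow> h a \<in> K"
  and hom_const: "k \<in> K \<Longrightarrow> h k = k"
  and hom_add: "a \<in> S \<Longrightarrow> b \<in> S \<Longrightarrow> h (a + b) = h a + h b"
  and hom_mult: "a \<in> S \<Longrightarrow> b \<in> S \<Longrightarrow> h (a * b) = h a * h b"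
  using h by (auto simp: K_hom_def)

lemma hom_zero: "h 0 = 0" and hom_one: "h 1 = 1"
  using hom_const K by (auto simp: subfield_of_C_def)

lemma hom_diff: "a \<in> S \<Longrightarrow> b \<in> S \<Longrightarrow> h (a - b) = h a - h b"
  using hom_add[of "a - b" b] diff_closed by (simp add: algebra_simps)

lemma hom_sum: "(\<And>i. i \<in> A \<Longrightarrow> f i \<in> S) \<Longrightarrow> h (sum f A) = (\<Sum>i\<in>A. h (f i))"
  by (induction A rule: infinite_finite_induct) (auto simp: hom_zero hom_add sum_closed)

lemma hom_prod: "(\<And>i. i \<in> A \<Longrightarrow> f i \<in> S) \<Longrightarrow> h (prod f A) = (\<Prod>i\<in>A. h (f i))"
  by (induction A rule: infinite_finite_induct) (auto simp: hom_one hom_mult prod_closed)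

lemma hom_power: "a \<in> S \<Longrightarrow> h (a ^ m) = h a ^ m"
  by (induction m) (auto simp: hom_one hom_mult power_closed)

lemma map_poly_hom_add: "p \<in> polys_over S \<Longrightarrow> q \<in> polys_over S \<Longrightarrow>
    map_poly h (p + q) = map_poly h p + map_poly h q"
  and map_poly_hom_smult: "a \<in> S \<Longrightarrow> p \<in> polys_over S \<Longrightarrow>
    map_poly h (Polynomial.smult a p) = Polynomial.smult (h a) (map_poly h p)"
  by (intro poly_eqI; simp add: coeff_map_poly hom_zero hom_add hom_mult polys_over_def)+

lemma map_poly_hom_mult: "p \<in> polys_over S \<Longrightarrow> q \<in> polys_over S \<Longrightarrow>
    map_poly h (p * q) = map_poly h p * map_poly h q"
  by (intro poly_eqI)
    (simp add: coeff_map_poly hom_zero coeff_mult hom_sum hom_mult mult_closed polys_over_def)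

text \<open>The extension sends \<open>c\<close> to \<open>a\<close>. The hypothesis
  \<open>van\<close>, applied to the difference of two polynomials with the same value at
  \<open>c\<close>, makes it independent of the representative picked by
  \<open>SOME\<close>.\<close>

lemma hom_to_adjoin:
  assumes a: "a \<in> K"
    and van: "\<And>r. r \<in> polys_over S \<Longrightarrow> poly r c = 0 \<Longrightarrow> poly (map_poly h r) a = 0"
  obtains h' where "K_hom K (adjoin S c) h'"
    "\<And>p. p \<in> polys_over S \<Longrightarrow> h' (poly p c) = poly (map_poly h p) a"
proof -
  define h' where "h' z = poly (map_poly h (SOME p. p \<in> polys_over S \<and> poly p c = z)) a" for z
  have eval: "h' (poly p c) = poly (map_poly h p) a" if p: "p \<in> polys_over S" for p
  proof -
    define q where "q = (SOME q. q \<in> polys_over S \<and> poly q c = poly p c)"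
    have q: "q \<in> polys_over S" "poly q c = poly p c"
      unfolding q_def using someI[of "\<lambda>q. q \<in> polys_over S \<and> poly q c = poly p c" p] p by auto
    have "poly (map_poly h (q - p)) a = 0"
      by (rule van) (use q p polys_diff in auto)
    moreover have "map_poly h q = map_poly h (q - p) + map_poly h p"
      using map_poly_hom_add[of "q - p" p] polys_diff q p by simp
    ultimately show ?thesis by (simp add: h'_def flip: q_def)
  qed
  have "K_hom K (adjoin S c) h'"
    unfolding K_hom_def
  proof (intro conjI ballI)
    show "h' ` adjoin S c \<subseteq> K"
    proof clarify
      fix z assume "z \<in> adjoin S c"
      then obtain p where p: "p \<in> polys_over S" "z = poly p c" by (auto simp: adjoin_def)
      have "subalgebra_of_C K K" using K by (auto simp: subalgebra_of_C_def subfield_of_C_def)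
      then interpret K: subalgebra_of_C K K .
      have "h' z = (\<Sum>i\<le>degree (map_poly h p). coeff (map_poly h p) i * a ^ i)"
        using eval[OF p(1)] p(2) by (simp only: poly_altdef)
      also have "\<dots> \<in> K"
        using p(1) a
        by (auto simp: coeff_map_poly hom_zero polys_over_def
            intro!: K.sum_closed K.mult_closed K.power_closed hom_in)
      finally show "h' z \<in> K" .
    qed
    fix k assume k: "k \<in> K"
    have "[:k:] \<in> polys_over S"
      using k KS by (auto simp: polys_over_def coeff_pCons zero_closed split: nat.splits)
    from eval[OF this] show "h' k = k"
      using hom_const[OF k] hom_zero by (cases "k = 0") (simp_all add: map_poly_pCons)
  next
    fix y z assume "y \<in> adjoin S c" "z \<in> adjoin S c"
    then obtain p q where pq: "p \<in> polys_over S" "q \<in> polys_over S" "y = poly p c" "z = poly q c"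
      by (auto simp: adjoin_def)
    show "h' (y + z) = h' y + h' z"
      using eval[of "p + q"] eval[of p] eval[of q] pq by (simp add: polys_add map_poly_hom_add)
    show "h' (y * z) = h' y * h' z"
      using eval[of "p * q"] eval[of p] eval[of q] pq by (simp add: polys_mult map_poly_hom_mult)
  qed
  then show thesis using that eval by blast
qed

end

text \<open>The nonvanishing of \<open>f\<close> is traded for that of one element \<open>g\<close>
  of the smaller ring, as needed to induct over generators. Every \<open>a\<close> in
  \<open>K\<close> is an admissible image of \<open>c\<close>, and once \<open>h\<close> does not
  kill the leading coefficient of \<open>p\<close>, only finitely many \<open>a\<close> are roots of
  the image of \<open>p\<close>.\<close>

lemma hom_extension_transcendental:
  assumes trans: "\<And>r. r \<in> polys_over S \<Longrightarrow> poly r c = 0 \<Longrightarrow> r = 0"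
    and f: "f \<in> adjoin S c" "f \<noteq> 0"
  shows "\<exists>g\<in>S. g \<noteq> 0 \<and>
    (\<forall>h. K_hom K S h \<longrightarrow> h g \<noteq> 0 \<longrightarrow> (\<exists>h'. K_hom K (adjoin S c) h' \<and> h' f \<noteq> 0))"
proof -
  obtain p where p: "p \<in> polys_over S" "f = poly p c" using f by (auto simp: adjoin_def)
  have "p \<noteq> 0" using f p by auto
  show ?thesis
  proof (intro bexI[of _ "lead_coeff p"] conjI allI impI)
    show "lead_coeff p \<noteq> 0" "lead_coeff p \<in> S" using \<open>p \<noteq> 0\<close> p by (auto simp: polys_over_def)
    fix h assume h: "K_hom K S h" "h (lead_coeff p) \<noteq> 0"
    have "coeff (map_poly h p) (degree p) \<noteq> 0" using h hom_zero[OF h(1)] by (simp add: coeff_map_poly)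
    then have "finite {a. poly (map_poly h p) a = 0}"
      by (intro poly_roots_finite) auto
    moreover have "infinite K"
    proof
      assume "finite K"
      have "of_nat m \<in> K" for m
        using K by (induction m) (auto simp: subfield_of_C_def)
      then have "range (of_nat :: nat \<Rightarrow> complex) \<subseteq> K" by auto
      from finite_subset[OF this \<open>finite K\<close>] show False
        by (simp add: finite_image_iff)
    qed
    ultimately have "\<not> K \<subseteq> {a. poly (map_poly h p) a = 0}"
      using finite_subset[of K "{a. poly (map_poly h p) a = 0}"] by metis
    then obtain a where a: "a \<in> K" "poly (map_poly h p) a \<noteq> 0"
      by blast
    obtain h' where "K_hom K (adjoin S c) h'"
      "\<And>p. p \<in> polys_over S \<Longrightarrow> h' (poly p c) = poly (map_poly h p) a"
      by (rule hom_to_adjoin[OF h(1) a(1), of c]) (auto dest: trans)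
    then show "\<exists>h'. K_hom K (adjoin S c) h' \<and> h' f \<noteq> 0" using p a by auto
  qed
qed

text \<open>The image of \<open>c\<close> must now be a root \<open>a\<close> of the image of a
  least-degree annihilator \<open>p\<close> of \<open>c\<close>. A Bezout identity
  \<open>u * r + v * p = [:\<delta>:]\<close>, mapped by \<open>h\<close> and evaluated at
  \<open>a\<close>, shows that \<open>f = poly r c\<close> is not killed when
  \<open>h \<delta>\<close> is nonzero.\<close>

lemma hom_extension_algebraic:
  assumes alg: "alg_closed_subfield K"
    and ex: "r0 \<in> polys_over S" "poly r0 c = 0" "r0 \<noteq> 0"
    and f: "f \<in> adjoin S c" "f \<noteq> 0"
  shows "\<exists>g\<in>S. g \<noteq> 0 \<and>
    (\<forall>h. K_hom K S h \<longrightarrow> h g \<noteq> 0 \<longrightarrow> (\<exists>h'. K_hom K (adjoin S c) h' \<and> h' f \<noteq> 0))"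
proof -
  obtain p where p: "p \<in> polys_over S" "poly p c = 0" "p \<noteq> 0"
    and min: "\<And>q. q \<in> polys_over S \<Longrightarrow> poly q c = 0 \<Longrightarrow> degree q < degree p \<Longrightarrow> q = 0"
    using ex_has_least_nat[of "\<lambda>p. p \<in> polys_over S \<and> poly p c = 0 \<and> p \<noteq> 0" r0 degree] ex
    by (metis linorder_not_less)
  have deg: "degree p \<ge> 1"
  proof (rule ccontr)
    assume "\<not> degree p \<ge> 1"
    then obtain a where "p = [:a:]" by (metis degree_eq_zeroE not_less_eq_eq One_nat_def le_0_eq)
    then show False using p by auto
  qed
  obtain r where r: "r \<in> polys_over S" "f = poly r c" using f by (auto simp: adjoin_def)
  \<comment> \<open>The ideal generated by \<open>p\<close> and \<open>r\<close>. Its least-degree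
    nonzero element \<open>d\<close> divides both up to powers of \<open>lead_coeff d\<close>, so it
    serves as a gcd.\<close>
  define I where "I = {u * r + v * p | u v. u \<in> polys_over S \<and> v \<in> polys_over S}"
  have "p \<in> I" "r \<in> I"
    unfolding I_def using polys_zero polys_one by (force intro: exI[of _ 0] exI[of _ 1])+
  obtain d where d: "d \<in> I" "d \<noteq> 0" and dmin: "\<And>e. e \<in> I \<Longrightarrow> degree e < degree d \<Longrightarrow> e = 0"
    using ex_has_least_nat[of "\<lambda>d. d \<in> I \<and> d \<noteq> 0" p degree] \<open>p \<in> I\<close> p by (metis linorder_not_less)
  obtain u v where uv: "u \<in> polys_over S" "v \<in> polys_over S" "d = u * r + v * p"
    using d by (auto simp: I_def)
  have dS: "d \<in> polys_over S"
    using uv p r by (auto intro!: polys_add polys_mult)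
  have divides: "\<exists>m s. s \<in> polys_over S \<and> Polynomial.smult (lead_coeff d ^ m) e = d * s" if e: "e \<in> I" for e
  proof -
    obtain u' v' where uv': "u' \<in> polys_over S" "v' \<in> polys_over S" "e = u' * r + v' * p"
      using e by (auto simp: I_def)
    have "e \<in> polys_over S" using uv' p r by (auto intro!: polys_add polys_mult)
    then obtain m s t where mst: "s \<in> polys_over S" "t \<in> polys_over S"
      "Polynomial.smult (lead_coeff d ^ m) e = d * s + t" "t = 0 \<or> degree t < degree d"
      using pseudo_division[OF dS d(2)] by blast
    define l where "l = lead_coeff d ^ m"
    have l: "l \<in> S" using dS by (auto simp: l_def polys_over_def intro: power_closed)
    have "t = Polynomial.smult l e - s * d"
      using mst(3) by (simp add: l_def)
    also have "\<dots> = Polynomial.smult l u' * r + Polynomial.smult l v' * p - s * (u * r + v * p)"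
      by (simp only: uv'(3) uv(3)[symmetric] smult_add_right mult_smult_left)
    also have "\<dots> = (Polynomial.smult l u' - u * s) * r + (Polynomial.smult l v' - v * s) * p"
      by (simp only: algebra_simps)
    finally have "t = (Polynomial.smult l u' - u * s) * r + (Polynomial.smult l v' - v * s) * p" .
    then have "t \<in> I"
      unfolding I_def using l uv uv' mst by (blast intro: polys_diff polys_smult polys_mult)
    then have "t = 0" using mst(4) dmin by blast
    then show ?thesis using mst by auto
  qed
  obtain m s where ms: "s \<in> polys_over S" "Polynomial.smult (lead_coeff d ^ m) p = d * s"
    using divides[OF \<open>p \<in> I\<close>] by blast
  obtain m' s' where ms': "Polynomial.smult (lead_coeff d ^ m') r = d * s'"
    using divides[OF \<open>r \<in> I\<close>] by blast
  \<comment> \<open>If \<open>d\<close> vanished at \<open>c\<close>, so would \<open>r\<close>, and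
    \<open>f\<close> would be zero. Hence the cofactor \<open>s\<close> of \<open>p\<close> vanishes
    at \<open>c\<close>, and minimality of \<open>degree p\<close> forces \<open>d\<close> to be
    constant.\<close>
  have "poly d c \<noteq> 0"
  proof
    assume "poly d c = 0"
    then have "poly (Polynomial.smult (lead_coeff d ^ m') r) c = 0" by (simp add: ms')
    then show False using d r f by simp
  qed
  moreover have "poly d c * poly s c = 0"
    using arg_cong[OF ms(2), of "\<lambda>q. poly q c"] p by simp
  ultimately have "poly s c = 0" by simp
  moreover have "s \<noteq> 0" using ms d p by auto
  ultimately have "degree s \<ge> degree p" using min ms by (meson linorder_not_less)
  moreover have "degree p = degree d + degree s"
    using arg_cong[OF ms(2), of degree] d \<open>s \<noteq> 0\<close> by (simp add: degree_mult_eq)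
  ultimately have "degree d = 0" by simp
  then obtain \<delta> where \<delta>: "d = [:\<delta>:]" by (rule degree_eq_zeroE)
  have \<delta>S: "\<delta> \<in> S" using dS unfolding \<delta> polys_over_def by (metis coeff_pCons_0 mem_Collect_eq)
  have lcS: "lead_coeff p \<in> S" using p by (auto simp: polys_over_def)
  show ?thesis
  \<comment> \<open>The factor \<open>lead_coeff p\<close> keeps the image of \<open>p\<close>
    nonconstant, so that it has a root, and lets its powers be cancelled after pseudo-division; the
    factor \<open>\<delta>\<close> protects \<open>f\<close>.\<close>
  proof (intro bexI[of _ "\<delta> * lead_coeff p"] conjI allI impI)
    show "\<delta> * lead_coeff p \<noteq> 0" using \<delta> d p by auto
    show "\<delta> * lead_coeff p \<in> S" using \<delta>S lcS by (rule mult_closed)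
    fix h assume h: "K_hom K S h" "h (\<delta> * lead_coeff p) \<noteq> 0"
    then have nz: "h \<delta> \<noteq> 0" "h (lead_coeff p) \<noteq> 0"
      using hom_mult[OF h(1) \<delta>S lcS] by auto
    have "degree (map_poly h p) \<ge> degree p"
      by (rule le_degree) (use nz in \<open>simp add: coeff_map_poly hom_zero[OF h(1)]\<close>)
    then have "degree (map_poly h p) \<ge> 1" using deg by simp
    moreover have "\<forall>i. coeff (map_poly h p) i \<in> K"
      using p hom_in[OF h(1)] by (auto simp: coeff_map_poly hom_zero[OF h(1)] polys_over_def)
    ultimately obtain a where a: "a \<in> K" "poly (map_poly h p) a = 0"
      using alg by (auto simp: alg_closed_subfield_def)
    have van: "poly (map_poly h q) a = 0" if q: "q \<in> polys_over S" "poly q c = 0" for q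
    proof -
      obtain m s t where mst: "s \<in> polys_over S" "t \<in> polys_over S"
        "Polynomial.smult (lead_coeff p ^ m) q = p * s + t" "t = 0 \<or> degree t < degree p"
        using pseudo_division[OF p(1,3) q(1)] by blast
      have "poly t c = 0" using arg_cong[OF mst(3), of "\<lambda>w. poly w c"] p q by simp
      then have "t = 0" using min mst by blast
      then have "Polynomial.smult (h (lead_coeff p ^ m)) (map_poly h q) = map_poly h p * map_poly h s"
        using mst p q lcS
        by (simp flip: map_poly_hom_smult[OF h(1)] map_poly_hom_mult[OF h(1)] add: power_closed)
      from arg_cong[OF this, of "\<lambda>w. poly w a"] show ?thesis
        using nz a by (simp add: hom_power[OF h(1) lcS])
    qed
    obtain h' where h': "K_hom K (adjoin S c) h'"
      "\<And>p. p \<in> polys_over S \<Longrightarrow> h' (poly p c) = poly (map_poly h p) a"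
      using hom_to_adjoin[OF h(1) a(1) van] by blast
    have "map_poly h u * map_poly h r + map_poly h v * map_poly h p = map_poly h [:\<delta>:]"
      using uv p r \<delta> by (simp add: polys_mult flip: map_poly_hom_mult[OF h(1)] map_poly_hom_add[OF h(1)])
    from arg_cong[OF this, of "\<lambda>w. poly w a"] have "poly (map_poly h r) a \<noteq> 0"
      using a nz \<delta> d(2) by (auto simp: map_poly_pCons hom_zero[OF h(1)])
    then show "\<exists>h'. K_hom K (adjoin S c) h' \<and> h' f \<noteq> 0" using h' r by auto
  qed
qed

end

fun generated_algebra :: "complex set \<Rightarrow> complex list \<Rightarrow> complex set" where
  "generated_algebra K [] = K"
| "generated_algebra K (c # cs) = adjoin (generated_algebra K cs) c"

lemma subalgebra_generated:
  assumes "subfield_of_C K"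
  shows "subalgebra_of_C K (generated_algebra K cs)"
proof (induction cs)
  case Nil
  then show ?case using assms by (auto simp: subalgebra_of_C_def subfield_of_C_def)
qed (simp add: subalgebra_of_C.subalgebra_adjoin)

lemma generators_in_generated:
  assumes "subfield_of_C K"
  shows "set cs \<subseteq> generated_algebra K cs"
proof (induction cs)
  case (Cons c cs)
  interpret subalgebra_of_C K "generated_algebra K cs" using subalgebra_generated[OF assms] .
  show ?case using Cons adjoin_generator adjoin_superset by auto
qed simp

text \<open>A form of the Nullstellensatz: a \<open>K\<close>-rational point at which
  \<open>f\<close> does not vanish. The induction removes one generator at a time, replacing
  \<open>f\<close> by the element \<open>g\<close> of the algebra below.\<close>

lemma nonvanishing_K_hom:
  assumes alg: "alg_closed_subfield K"
  shows "f \<in> generated_algebra K cs \<Longrightarrow> f \<noteq> 0 \<Longrightarrow>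
    \<exists>h. K_hom K (generated_algebra K cs) h \<and> h f \<noteq> 0"
proof (induction cs arbitrary: f)
  case Nil
  then show ?case by (intro exI[of _ "\<lambda>x. x"]) (auto simp: K_hom_def)
next
  case (Cons c cs)
  have K: "subfield_of_C K" using alg by (simp add: alg_closed_subfield_def)
  interpret subalgebra_of_C K "generated_algebra K cs" using subalgebra_generated[OF K] .
  let ?S = "generated_algebra K cs"
  have "\<exists>g\<in>?S. g \<noteq> 0 \<and> (\<forall>h. K_hom K ?S h \<longrightarrow> h g \<noteq> 0 \<longrightarrow> (\<exists>h'. K_hom K (adjoin ?S c) h' \<and> h' f \<noteq> 0))"
    using hom_extension_transcendental[of c f] hom_extension_algebraic[OF alg, of _ c f] Cons.prems
    by fastforce
  then show ?case using Cons.IH by fastforce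
qed

text \<open>If some coordinate \<open>c $ i\<close> were outside \<open>K\<close>, a \<open>K\<close>-homomorphism from the algebra generated by
  the coordinates to \<open>K\<close> could be chosen not to kill the product of all \<open>c $ i - e $ i\<close>, where \<open>e\<close> runs
  over the finitely many idempotents in \<open>K\<^sup>n\<close>; but it maps \<open>c\<close> to one of them.\<close>

lemma idempotent_in_Kvecs:
  assumes alg: "alg_closed_subfield K" and C: "comm_struct K n C"
    and fin: "finite {c \<in> carrier_vec n. mul n C c c = c}"
    and c: "c \<in> carrier_vec n" "mul n C c c = c"
  shows "c \<in> Kvecs K n"
proof (rule ccontr)
  assume "c \<notin> Kvecs K n"
  then obtain i where i: "i < n" "c $ i \<notin> K" using c by (auto simp: Kvecs_def)
  have K: "subfield_of_C K" using alg by (simp add: alg_closed_subfield_def)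
  define cs where "cs = map (\<lambda>i. c $ i) [0..<n]"
  define S where "S = generated_algebra K cs"
  interpret subalgebra_of_C K S unfolding S_def by (rule subalgebra_generated[OF K])
  have cS: "c $ j \<in> S" if "j < n" for j
    using generators_in_generated[OF K, of cs] that by (auto simp: S_def cs_def)
  define E where "E = {e \<in> Kvecs K n. mul n C e e = e}"
  have "finite E" by (rule finite_subset[OF _ fin]) (auto simp: E_def Kvecs_def)
  define f where "f = (\<Prod>e\<in>E. c $ i - e $ i)"
  have EK: "e $ i \<in> K" if "e \<in> E" for e using that i by (auto simp: E_def Kvecs_def)
  have fac: "c $ i - e $ i \<in> S" if "e \<in> E" for e
    using cS[OF i(1)] EK[OF that] KS by (auto intro: diff_closed)
  have "f \<in> S" unfolding f_def by (rule prod_closed) (rule fac)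
  moreover have "f \<noteq> 0" using i EK \<open>finite E\<close> by (auto simp: f_def)
  ultimately obtain h where h: "K_hom K S h" "h f \<noteq> 0"
    using nonvanishing_K_hom[OF alg] unfolding S_def by blast
  have CS: "C j k l \<in> K" if "j < n" "k < n" "l < n" for j k l
    using C that by (auto simp: comm_struct_def)
  define d where "d = vec n (\<lambda>j. h (c $ j))"
  \<comment> \<open>The structure constants lie in \<open>K\<close>, so \<open>h\<close> fixes them
    and preserves the idempotent equations.\<close>
  have "mul n C d d = d"
  proof (rule eq_vecI)
    fix l assume "l < dim_vec d"
    then have l: "l < n" by (simp add: d_def)
    have term_in: "c $ j * c $ k * C j k l \<in> S" if "j < n" "k < n" for j k
      using that l cS CS KS by (auto intro!: mult_closed)
    have "mul n C d d $ l = (\<Sum>j<n. \<Sum>k<n. h (c $ j) * h (c $ k) * C j k l)"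
      using l by (simp add: mul_def d_def)
    also have "\<dots> = (\<Sum>j<n. \<Sum>k<n. h (c $ j * c $ k * C j k l))"
    proof (intro sum.cong refl)
      fix j k assume jk: "j \<in> {..<n}" "k \<in> {..<n}"
      then have "C j k l \<in> S" "h (C j k l) = C j k l"
        using CS l KS hom_const[OF h(1)] by auto
      then show "h (c $ j) * h (c $ k) * C j k l = h (c $ j * c $ k * C j k l)"
        using jk cS by (simp add: hom_mult[OF h(1)] mult_closed)
    qed
    also have "\<dots> = (\<Sum>j<n. h (\<Sum>k<n. c $ j * c $ k * C j k l))"
      using term_in by (intro sum.cong refl hom_sum[OF h(1), symmetric]) auto
    also have "\<dots> = h (\<Sum>j<n. \<Sum>k<n. c $ j * c $ k * C j k l)"
      using term_in by (intro hom_sum[OF h(1), symmetric] sum_closed) auto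
    also have "\<dots> = h (mul n C c c $ l)" using l by (simp add: mul_def)
    also have "\<dots> = d $ l" using l c by (simp add: d_def)
    finally show "mul n C d d $ l = d $ l" .
  qed (simp add: mul_def d_def)
  then have "d \<in> E" using hom_in[OF h(1)] cS by (auto simp: E_def Kvecs_def d_def)
  have "h f = (\<Prod>e\<in>E. h (c $ i) - h (e $ i))"
    unfolding f_def using EK KS cS i by (subst hom_prod[OF h(1)]) (auto simp: hom_diff[OF h(1)] fac subset_eq)
  also have "\<dots> = (\<Prod>e\<in>E. d $ i - e $ i)"
    using EK hom_const[OF h(1)] i by (intro prod.cong) (auto simp: d_def)
  also have "\<dots> = 0" using \<open>d \<in> E\<close> \<open>finite E\<close> by (intro prod_zero) auto
  finally show False using h(2) by simp
qed

section \<open>Functions closed under squaring\<close>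

text \<open>An injective self-map of a finite set permutes it, so \<open>f\<close> lies on a cycle.
  The complement of the cycle is also preserved, which allows cycles to be split off one by
  one.\<close>

lemma funpow_orbit:
  fixes q :: "'b \<Rightarrow> 'b"
  assumes fin: "finite X" and sub: "q ` X \<subseteq> X" and inj: "inj_on q X" and f: "f \<in> X"
  obtains l where "l > 0" "(q ^^ l) f = f" "(\<lambda>k. (q ^^ k) f) ` {..<l} \<subseteq> X"
    "card ((\<lambda>k. (q ^^ k) f) ` {..<l}) = l"
    "q ` (X - (\<lambda>k. (q ^^ k) f) ` {..<l}) \<subseteq> X - (\<lambda>k. (q ^^ k) f) ` {..<l}"
proof -
  have inX: "(q ^^ k) g \<in> X" if "g \<in> X" for k g
    using that sub by (induction k) auto
  have cancel: "(q ^^ k) g = (q ^^ k) h \<Longrightarrow> g = h" if "g \<in> X" "h \<in> X" for g h k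
  proof (induction k)
    case (Suc k)
    then have "(q ^^ k) g = (q ^^ k) h"
      using inj inX that by (auto simp: inj_on_def)
    then show ?case using Suc by blast
  qed auto
  have shift: "(q ^^ (j - i)) f = f" if "i \<le> j" "(q ^^ i) f = (q ^^ j) f" for i j
  proof -
    have "(q ^^ i) ((q ^^ (j - i)) f) = (q ^^ (i + (j - i))) f"
      unfolding funpow_add by simp
    also have "\<dots> = (q ^^ i) f" using that by simp
    finally have "(q ^^ i) ((q ^^ (j - i)) f) = (q ^^ i) f" .
    then show ?thesis using cancel inX f by blast
  qed
  have "\<not> inj_on (\<lambda>k. (q ^^ k) f) (UNIV :: nat set)"
    using fin inX[OF f] by (meson finite_subset image_subsetI infinite_UNIV_nat finite_image_iff)
  then obtain i j where "i < j" "(q ^^ i) f = (q ^^ j) f"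
    unfolding inj_on_def by (metis linorder_neq_iff)
  then have ex: "\<exists>l>0. (q ^^ l) f = f"
    using shift by (meson less_imp_le zero_less_diff)
  define l where "l = (LEAST l. l > 0 \<and> (q ^^ l) f = f)"
  have l: "l > 0" "(q ^^ l) f = f"
    using LeastI_ex[OF ex] unfolding l_def by auto
  have least: "l \<le> m" if "m > 0" "(q ^^ m) f = f" for m
    unfolding l_def using that by (auto intro: Least_le)
  let ?O = "(\<lambda>k. (q ^^ k) f) ` {..<l}"
  have "inj_on (\<lambda>k. (q ^^ k) f) {..<l}"
  proof (rule linorder_inj_onI)
    fix i j assume ij: "i < j" "i \<in> {..<l}" "j \<in> {..<l}"
    show "(q ^^ i) f \<noteq> (q ^^ j) f"
      using shift[of i j] least[of "j - i"] ij by force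
  qed auto
  then have card: "card ?O = l" by (simp add: card_image)
  have "q g \<notin> ?O" if g: "g \<in> X" "g \<notin> ?O" for g
  proof
    assume "q g \<in> ?O"
    then obtain k where k: "k < l" "q g = (q ^^ k) f" by auto
    \<comment> \<open>The predecessor of position \<open>k\<close> on the cycle; position 0 is
      preceded by \<open>l - 1\<close>.\<close>
    define k' where "k' = (if k = 0 then l - 1 else k - 1)"
    have "q ((q ^^ k') f) = (q ^^ Suc k') f" by simp
    also have "\<dots> = (q ^^ k) f"
    proof (cases "k = 0")
      case True
      then have "Suc k' = l" using l by (simp add: k'_def)
      then show ?thesis using True l by simp
    qed (simp add: k'_def)
    finally have "g = (q ^^ k') f"
      using inj g inX[OF f] k by (auto simp: inj_on_def)
    moreover have "k' < l" using k l by (auto simp: k'_def)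
    ultimately show False using g by auto
  qed
  then have "q ` (X - ?O) \<subseteq> X - ?O" using sub by auto
  then show thesis using that[OF l] card inX[OF f] by auto
qed

lemma funpow_square: "((\<lambda>f x. (f x)\<^sup>2) ^^ k) f x = (f x :: 'a :: monoid_mult) ^ (2 ^ k)"
proof (induction k)
  case (Suc k)
  then show ?case by (simp add: mult.commute[of 2] power_mult)
qed simp

text \<open>A function \<open>f\<close> lying on a cycle of length \<open>l\<close> of the squaring map takes values among the
  \<open>(2^l - 1)\<close>-th roots of unity, and on each of its fibres the functions off that cycle still
  separate points.\<close>

lemma card_le_of_squaring_cycle:
  fixes X :: "('a \<Rightarrow> complex) set"
  defines "q \<equiv> \<lambda>f x. (f x)\<^sup>2"
  assumes G: "finite G" and nz: "\<And>f x. f \<in> X \<Longrightarrow> x \<in> G \<Longrightarrow> f x \<noteq> 0"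
    and sep: "\<And>x y. x \<in> G \<Longrightarrow> y \<in> G \<Longrightarrow> x \<noteq> y \<Longrightarrow> \<exists>f\<in>X. f x \<noteq> f y"
    and f: "f \<in> X" and l: "l > 0" "(q ^^ l) f = f"
    and bound: "\<And>H. H \<subseteq> G \<Longrightarrow>
      (\<And>x y. x \<in> H \<Longrightarrow> y \<in> H \<Longrightarrow> x \<noteq> y \<Longrightarrow> \<exists>g\<in>X - (\<lambda>k. (q ^^ k) f) ` {..<l}. g x \<noteq> g y) \<Longrightarrow>
      card H \<le> b"
  shows "card G \<le> (2 ^ l - 1) * b"
proof -
  have root: "f x ^ (2 ^ l - 1) = 1" if "x \<in> G" for x
  proof -
    have "f x ^ (2 ^ l) = f x" using l funpow_square[of l f x] by (simp add: q_def)
    moreover have "f x ^ (2 ^ l) = f x * f x ^ (2 ^ l - 1)"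
      by (metis power_eq_if power_not_zero zero_neq_numeral)
    ultimately show ?thesis using nz[OF f that] by simp
  qed
  have pos: "(2::nat) ^ l - 1 > 0"
    using one_less_power[of "2::nat" l] l by simp
  have im: "card (f ` G) \<le> 2 ^ l - 1"
  proof -
    have "card (f ` G) \<le> card {z::complex. z ^ (2 ^ l - 1) = 1}"
      by (rule card_mono) (use root pos finite_roots_unity in auto)
    then show ?thesis using card_roots_unity_eq[OF pos] by simp
  qed
  have fib: "card {x \<in> G. f x = v} \<le> b" for v
  proof (rule bound)
    fix x y assume xy: "x \<in> {x \<in> G. f x = v}" "y \<in> {x \<in> G. f x = v}" "x \<noteq> y"
    then obtain g where g: "g \<in> X" "g x \<noteq> g y" using sep by blast
    \<comment> \<open>Functions on the cycle are powers of \<open>f\<close>, hence constant on this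
      fibre and unable to separate \<open>x\<close> from \<open>y\<close>.\<close>
    have "g \<noteq> (q ^^ k) f" for k
      using g xy by (auto simp: q_def funpow_square)
    then show "\<exists>g\<in>X - (\<lambda>k. (q ^^ k) f) ` {..<l}. g x \<noteq> g y" using g by blast
  qed auto
  have "card G = card (\<Union>v\<in>f ` G. {x \<in> G. f x = v})"
    by (rule arg_cong[of _ _ card]) auto
  also have "\<dots> \<le> (\<Sum>v\<in>f ` G. card {x \<in> G. f x = v})"
    by (rule card_UN_le) (use G in auto)
  also have "\<dots> \<le> card (f ` G) * b"
    using sum_bounded_above[of "f ` G" "\<lambda>v. card {x \<in> G. f x = v}" b] fib by simp
  also have "\<dots> \<le> (2 ^ l - 1) * b" using im by simp
  finally show ?thesis .
qed

text \<open>Splitting off a squaring cycle of length \<open>l\<close> costs a factor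
  \<open>2 ^ l - 1\<close>, which is less than \<open>2 ^ l\<close>; induction handles the
  rest.\<close>

lemma card_le_two_power_of_squaring_closed:
  fixes X :: "('a \<Rightarrow> complex) set"
  assumes "finite X" "(\<lambda>f x. (f x)\<^sup>2) ` X \<subseteq> X" "inj_on (\<lambda>f x. (f x)\<^sup>2) X"
    and "finite G" "\<And>f x. f \<in> X \<Longrightarrow> x \<in> G \<Longrightarrow> f x \<noteq> 0"
    and "\<And>x y. x \<in> G \<Longrightarrow> y \<in> G \<Longrightarrow> x \<noteq> y \<Longrightarrow> \<exists>f\<in>X. f x \<noteq> f y"
  shows "card G \<le> 2 ^ card X"
  using assms
proof (induction "card X" arbitrary: X G rule: less_induct)
  case less
  show ?case
  proof (cases "X = {}")
    case True
    then have "card G \<le> 1" using less.prems(4,6) by (metis card_le_Suc0_iff_eq One_nat_def ex_in_conv)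
    then show ?thesis using True by simp
  next
    case False
    then obtain f where f: "f \<in> X" by blast
    obtain l where l: "l > 0" "((\<lambda>f x. (f x)\<^sup>2) ^^ l) f = f"
      "(\<lambda>k. ((\<lambda>f x. (f x)\<^sup>2) ^^ k) f) ` {..<l} \<subseteq> X"
      "card ((\<lambda>k. ((\<lambda>f x. (f x)\<^sup>2) ^^ k) f) ` {..<l}) = l"
      "(\<lambda>f x. (f x)\<^sup>2) ` (X - (\<lambda>k. ((\<lambda>f x. (f x)\<^sup>2) ^^ k) f) ` {..<l})
         \<subseteq> X - (\<lambda>k. ((\<lambda>f x. (f x)\<^sup>2) ^^ k) f) ` {..<l}"
      using funpow_orbit[OF less.prems(1-3) f] by blast
    define Y where "Y = X - (\<lambda>k. ((\<lambda>f x. (f x)\<^sup>2) ^^ k) f) ` {..<l}"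
    have cY: "card Y = card X - l" "l \<le> card X"
      unfolding Y_def using l(3,4) less.prems(1) by (auto simp: card_Diff_subset card_mono dest: card_mono[rotated])
    have "card G \<le> (2 ^ l - 1) * 2 ^ card Y"
    proof (rule card_le_of_squaring_cycle[where X = X and f = f and l = l])
      fix H assume H: "H \<subseteq> G"
        "\<And>x y. x \<in> H \<Longrightarrow> y \<in> H \<Longrightarrow> x \<noteq> y \<Longrightarrow> \<exists>g\<in>X - (\<lambda>k. ((\<lambda>f x. (f x)\<^sup>2) ^^ k) f) ` {..<l}. g x \<noteq> g y"
      show "card H \<le> 2 ^ card Y"
      proof (rule less.hyps)
        show "card Y < card X" using cY l(1) by linarith
        show "(\<lambda>f x. (f x)\<^sup>2) ` Y \<subseteq> Y" using l(5) by (simp add: Y_def)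
        show "inj_on (\<lambda>f x. (f x)\<^sup>2) Y" using less.prems(3) by (auto simp: Y_def inj_on_def)
        show "finite H" using H(1) less.prems(4) finite_subset by blast
      qed (use H less.prems in \<open>auto simp: Y_def\<close>)
    qed (use less.prems f l in auto)
    also have "\<dots> \<le> 2 ^ l * 2 ^ card Y" by simp
    also have "\<dots> = 2 ^ card X" using cY by (simp flip: power_add)
    finally show ?thesis .
  qed
qed

text \<open>Splitting off the cycle of \<open>f\<close> bounds \<open>card G\<close> by
  \<open>2 ^ card X - 2 ^ (card X - l)\<close>. As \<open>card X \<le> n\<close>, this reaches
  \<open>2 ^ n - 1\<close> only for \<open>l = card X = n\<close>. Then \<open>X\<close> consists of
  powers of \<open>f\<close>, so \<open>f\<close> alone separates points.\<close>

lemma injective_root_of_unity_function: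
  fixes X :: "('a \<Rightarrow> complex) set"
  assumes X: "finite X" "(\<lambda>f x. (f x)\<^sup>2) ` X \<subseteq> X" "inj_on (\<lambda>f x. (f x)\<^sup>2) X"
    and G: "finite G" and nz: "\<And>f x. f \<in> X \<Longrightarrow> x \<in> G \<Longrightarrow> f x \<noteq> 0"
    and sep: "\<And>x y. x \<in> G \<Longrightarrow> y \<in> G \<Longrightarrow> x \<noteq> y \<Longrightarrow> \<exists>f\<in>X. f x \<noteq> f y"
    and n: "n \<ge> 2" "card X \<le> n" "card G = 2 ^ n - 1"
  obtains f where "f \<in> X" "inj_on f G" "\<And>x. x \<in> G \<Longrightarrow> f x ^ (2 ^ n - 1) = 1"
proof -
  have n4: "(2::nat) ^ n \<ge> 2 ^ 2" using n(1) by (intro power_increasing) auto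
  have "X \<noteq> {}"
  proof
    assume "X = {}"
    then have "card G \<le> 1" using sep G by (metis card_le_Suc0_iff_eq One_nat_def ex_in_conv)
    then show False using n4 n(3) by simp
  qed
  then obtain f where f: "f \<in> X" by blast
  obtain l where l: "l > 0" "((\<lambda>f x. (f x)\<^sup>2) ^^ l) f = f"
    "(\<lambda>k. ((\<lambda>f x. (f x)\<^sup>2) ^^ k) f) ` {..<l} \<subseteq> X"
    "card ((\<lambda>k. ((\<lambda>f x. (f x)\<^sup>2) ^^ k) f) ` {..<l}) = l"
    "(\<lambda>f x. (f x)\<^sup>2) ` (X - (\<lambda>k. ((\<lambda>f x. (f x)\<^sup>2) ^^ k) f) ` {..<l})
       \<subseteq> X - (\<lambda>k. ((\<lambda>f x. (f x)\<^sup>2) ^^ k) f) ` {..<l}"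
    using funpow_orbit[OF X f] by blast
  define O' where "O' = (\<lambda>k. ((\<lambda>f x. (f x)\<^sup>2) ^^ k) f) ` {..<l}"
  have cY: "card (X - O') = card X - l" "l \<le> card X"
    unfolding O'_def using l(3,4) X(1) by (auto simp: card_Diff_subset card_mono dest: card_mono[rotated])
  have "card G \<le> (2 ^ l - 1) * 2 ^ card (X - O')"
  proof (rule card_le_of_squaring_cycle[where X = X and f = f and l = l])
    fix H assume H: "H \<subseteq> G"
      "\<And>x y. x \<in> H \<Longrightarrow> y \<in> H \<Longrightarrow> x \<noteq> y \<Longrightarrow> \<exists>g\<in>X - (\<lambda>k. ((\<lambda>f x. (f x)\<^sup>2) ^^ k) f) ` {..<l}. g x \<noteq> g y"
    show "card H \<le> 2 ^ card (X - O')"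
    proof (rule card_le_two_power_of_squaring_closed)
      show "inj_on (\<lambda>f x. (f x)\<^sup>2) (X - O')" using X(3) by (auto simp: inj_on_def)
      show "(\<lambda>f x. (f x)\<^sup>2) ` (X - O') \<subseteq> X - O'" using l(5) by (simp add: O'_def)
      show "finite H" using H(1) G finite_subset by blast
    qed (use H X nz in \<open>auto simp: O'_def\<close>)
  qed (use G nz sep f l in auto)
  also have "\<dots> = 2 ^ card X - 2 ^ card (X - O')"
    using cY by (simp add: diff_mult_distrib flip: power_add)
  finally have le: "2 ^ n - 1 \<le> 2 ^ card X - (2::nat) ^ card (X - O')" using n by simp
  have "l = n"
  proof (rule ccontr)
    assume "l \<noteq> n"
    show False
    proof (cases "card X = n")
      case True
      then have "card (X - O') \<ge> 1" using cY \<open>l \<noteq> n\<close> by simp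
      then have "(2::nat) ^ card (X - O') \<ge> 2 ^ 1" by (intro power_increasing) auto
      then show False using le True n4 by simp
    next
      case False
      then have "(2::nat) ^ Suc (card X) \<le> 2 ^ n" using n(2) by (intro power_increasing) auto
      then show False using le n4 by simp
    qed
  qed
  then have XO: "X = O'" using cY n(2) l(3,4) X(1) by (metis O'_def card_seteq)
  have inj: "inj_on f G"
  proof (rule inj_onI, rule ccontr)
    fix x y assume xy: "x \<in> G" "y \<in> G" "f x = f y" "x \<noteq> y"
    then obtain k where "((\<lambda>f x. (f x)\<^sup>2) ^^ k) f x \<noteq> ((\<lambda>f x. (f x)\<^sup>2) ^^ k) f y"
      using sep[of x y] by (auto simp: XO O'_def)
    then show False using xy by (simp add: funpow_square)
  qed
  have "f x ^ (2 ^ n - 1) = 1" if "x \<in> G" for x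
  proof -
    have "f x ^ (2 ^ n) = f x" using l(2) funpow_square[of l f x] \<open>l = n\<close> by simp
    moreover have "f x ^ (2 ^ n) = f x * f x ^ (2 ^ n - 1)"
      by (metis power_eq_if power_not_zero zero_neq_numeral)
    ultimately show ?thesis using nz[OF f that] by simp
  qed
  then show thesis using that f inj by blast
qed

section \<open>Characters of finite medial quasigroups\<close>

text \<open>The product of the periods of the individual points is a common period.\<close>

lemma uniform_period:
  assumes fin: "finite G" and r: "r ` G \<subseteq> G" "inj_on r G"
  obtains q where "q > 0" "\<And>x. x \<in> G \<Longrightarrow> (r ^^ q) x = x"
proof -
  have "\<exists>l>0. (r ^^ l) x = x" if "x \<in> G" for x
    using funpow_orbit[OF fin r that] by metis
  then obtain l where l: "\<And>x. x \<in> G \<Longrightarrow> l x > 0 \<and> (r ^^ l x) x = x" by metis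
  have per: "(r ^^ (l x * k)) x = x" if "x \<in> G" for x k
    using l[OF that] by (induction k) (simp_all add: funpow_add)
  have "(r ^^ (\<Prod>x\<in>G. l x)) x = x" if "x \<in> G" for x
    using per[OF that, of "\<Prod>y\<in>G - {x}. l y"] that fin by (simp add: prod.remove)
  moreover have "(\<Prod>x\<in>G. l x) > 0" using l by (intro prod_pos) auto
  ultimately show thesis using that by blast
qed

text \<open>The discrete Fourier components of \<open>k \<mapsto> u (r\<^sup>k x)\<close> sum to \<open>q * u x\<close>, so one of them
  separates any two points that \<open>u\<close> separates.\<close>

lemma separating_fourier_component:
  fixes u :: "'a \<Rightarrow> complex"
  assumes q: "q > 0" and xy: "u x \<noteq> u y"
  obtains z where "z ^ q = 1" "(\<Sum>k<q. z ^ k * u ((r ^^ k) x)) \<noteq> (\<Sum>k<q. z ^ k * u ((r ^^ k) y))"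
proof -
  \<comment> \<open>A primitive \<open>q\<close>-th root of unity; its powers index the Fourier
    components.\<close>
  define w where "w = cis (2 * pi / real q)"
  have wk: "w ^ k = cis (2 * pi * real k / real q)" for k
    by (simp add: w_def DeMoivre mult_ac)
  have wq: "w ^ q = 1" using q by (simp add: wk)
  have ne: "w ^ k \<noteq> 1" if "0 < k" "k < q" for k
    using inj_onD[OF bij_betw_imp_inj_on[OF bij_betw_roots_unity[OF q]], of k 0] that wk by auto
  have geo: "(\<Sum>j<q. (w ^ j) ^ k) = (if k = 0 then of_nat q else 0)" if "k < q" for k
  proof -
    have "(\<Sum>j<q. (w ^ j) ^ k) = (\<Sum>j<q. (w ^ k) ^ j)"
      by (simp add: mult.commute flip: power_mult)
    also have "\<dots> = (if k = 0 then of_nat q else 0)"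
    proof (cases "k = 0")
      case False
      have "(w ^ k) ^ q = 1" using wq by (metis mult.commute power_mult power_one)
      then show ?thesis using False ne[of k] that by (simp add: geometric_sum)
    qed simp
    finally show ?thesis .
  qed
  have tot: "(\<Sum>j<q. \<Sum>k<q. (w ^ j) ^ k * u ((r ^^ k) v)) = of_nat q * u v" for v
  proof -
    have "(\<Sum>j<q. \<Sum>k<q. (w ^ j) ^ k * u ((r ^^ k) v)) = (\<Sum>k<q. (\<Sum>j<q. (w ^ j) ^ k) * u ((r ^^ k) v))"
      by (subst sum.swap) (simp add: sum_distrib_right)
    also have "\<dots> = (\<Sum>k<q. if k = 0 then of_nat q * u v else 0)"
      by (intro sum.cong) (auto simp: geo)
    also have "\<dots> = of_nat q * u v" using q by (simp add: sum.delta)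
    finally show ?thesis .
  qed
  have "\<exists>j<q. (\<Sum>k<q. (w ^ j) ^ k * u ((r ^^ k) x)) \<noteq> (\<Sum>k<q. (w ^ j) ^ k * u ((r ^^ k) y))"
  proof (rule ccontr)
    assume "\<not> ?thesis"
    then have eq: "(\<Sum>k<q. (w ^ j) ^ k * u ((r ^^ k) x)) = (\<Sum>k<q. (w ^ j) ^ k * u ((r ^^ k) y))"
      if "j \<in> {..<q}" for j using that by blast
    have "of_nat q * u x = of_nat q * u y"
      unfolding tot[symmetric] by (rule sum.cong[OF refl eq])
    then show False using q xy by simp
  qed
  then obtain j where "(\<Sum>k<q. (w ^ j) ^ k * u ((r ^^ k) x)) \<noteq> (\<Sum>k<q. (w ^ j) ^ k * u ((r ^^ k) y))"
    by blast
  moreover have "(w ^ j) ^ q = 1" using wq by (metis mult.commute power_mult power_one)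
  ultimately show thesis using that by blast
qed

text \<open>This provides spans of functions and the bound on the size of independent sets.\<close>

interpretation fun_space: vector_space "\<lambda>(c::complex) (f :: 'a \<Rightarrow> complex) x. c * f x"
  by unfold_locales (auto simp: fun_eq_iff algebra_simps)

lemma sum_fun_apply: "(\<Sum>i\<in>I. f i) x = (\<Sum>i\<in>I. f i x)"
  for f :: "'i \<Rightarrow> 'a \<Rightarrow> 'b :: comm_monoid_add"
  by (induction I rule: infinite_finite_induct) auto

section \<open>The abelian group of a finite idempotent medial quasigroup\<close>

locale medial_quasigroup =
  fixes G :: "'a set" and m :: "'a \<Rightarrow> 'a \<Rightarrow> 'a" (infixl "\<star>" 70) and e :: 'a
  assumes fin: "finite G" and e: "e \<in> G"
    and closed: "x \<in> G \<Longrightarrow> y \<in> G \<Longrightarrow> x \<star> y \<in> G"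
    and comm: "x \<in> G \<Longrightarrow> y \<in> G \<Longrightarrow> x \<star> y = y \<star> x"
    and idem: "x \<in> G \<Longrightarrow> x \<star> x = x"
    and medial: "x \<in> G \<Longrightarrow> y \<in> G \<Longrightarrow> z \<in> G \<Longrightarrow> w \<in> G \<Longrightarrow> (x \<star> y) \<star> (z \<star> w) = (x \<star> z) \<star> (y \<star> w)"
    and cancel: "x \<in> G \<Longrightarrow> y \<in> G \<Longrightarrow> z \<in> G \<Longrightarrow> x \<star> y = x \<star> z \<Longrightarrow> y = z"
begin

definition period :: nat where
  "period = (SOME q. q > 0 \<and> (\<forall>x\<in>G. ((\<star>) e ^^ q) x = x))"

text \<open>The inverse of multiplication by \<open>e\<close>, that is, doubling in the group below.
  Writing it as an iterate lets \<open>pullback_double\<close> reduce it to multiplications.\<close>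

definition double :: "'a \<Rightarrow> 'a" where
  "double = (\<star>) e ^^ (period - 1)"

text \<open>The abelian group on \<open>G\<close> with neutral element \<open>e\<close>, in which \<open>x \<star> y\<close> is half of \<open>x + y\<close>.\<close>

definition gadd :: "'a \<Rightarrow> 'a \<Rightarrow> 'a" (infixl "\<oplus>\<^sub>G" 65) where
  "x \<oplus>\<^sub>G y = double (x \<star> y)"

lemma mult_e_inj: "inj_on ((\<star>) e) G" and mult_e_image: "(\<star>) e ` G \<subseteq> G"
  using cancel e closed by (auto intro: inj_onI)

lemma period: "period > 0" "x \<in> G \<Longrightarrow> ((\<star>) e ^^ period) x = x"
proof -
  have "\<exists>q. q > 0 \<and> (\<forall>x\<in>G. ((\<star>) e ^^ q) x = x)"
    using uniform_period[OF fin mult_e_image mult_e_inj] by metis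
  from someI_ex[OF this] show "period > 0" "x \<in> G \<Longrightarrow> ((\<star>) e ^^ period) x = x"
    unfolding period_def by auto
qed

lemma funpow_closed: "r ` G \<subseteq> G \<Longrightarrow> x \<in> G \<Longrightarrow> (r ^^ k) x \<in> G"
  by (induction k) auto

lemma double_closed: "x \<in> G \<Longrightarrow> double x \<in> G"
  unfolding double_def by (rule funpow_closed[OF mult_e_image])

lemma mult_double: "x \<in> G \<Longrightarrow> e \<star> double x = x"
  using period(2)[of x] period(1) funpow.simps(2)[of "period - 1" "(\<star>) e"]
  by (simp add: double_def comp_def)

lemma double_mult: "x \<in> G \<Longrightarrow> double (e \<star> x) = x"
  using cancel[OF e, of "double (e \<star> x)" x] mult_double double_closed closed e by auto

lemma gadd_closed: "x \<in> G \<Longrightarrow> y \<in> G \<Longrightarrow> x \<oplus>\<^sub>G y \<in> G"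
  by (simp add: gadd_def double_closed closed)

lemma mult_gadd: "x \<in> G \<Longrightarrow> y \<in> G \<Longrightarrow> e \<star> (x \<oplus>\<^sub>G y) = x \<star> y"
  by (simp add: gadd_def mult_double closed)

lemma gadd_e: "x \<in> G \<Longrightarrow> x \<oplus>\<^sub>G e = x"
  using double_mult[of x] comm[of x e] e by (simp add: gadd_def)

text \<open>Multiplying twice by \<open>e\<close> turns the left side into
  \<open>(e \<star> x) \<star> (y \<star> z)\<close>, in which mediality exchanges \<open>x\<close>
  and \<open>y\<close>.\<close>

lemma gadd_left_commute:
  assumes "x \<in> G" "y \<in> G" "z \<in> G"
  shows "x \<oplus>\<^sub>G (y \<oplus>\<^sub>G z) = y \<oplus>\<^sub>G (x \<oplus>\<^sub>G z)"
proof -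
  have "e \<star> (e \<star> (x \<oplus>\<^sub>G (y \<oplus>\<^sub>G z))) = (e \<star> x) \<star> (y \<star> z)" if "x \<in> G" "y \<in> G" "z \<in> G" for x y z
    using that e medial[OF e e, of x "y \<oplus>\<^sub>G z"] idem[OF e] by (simp add: mult_gadd gadd_closed)
  then have "e \<star> (e \<star> (x \<oplus>\<^sub>G (y \<oplus>\<^sub>G z))) = e \<star> (e \<star> (y \<oplus>\<^sub>G (x \<oplus>\<^sub>G z)))"
    using assms medial[OF e, of x y z] by simp
  then show ?thesis using cancel e closed gadd_closed assms by meson
qed

lemma gadd_inj: "x \<in> G \<Longrightarrow> inj_on ((\<oplus>\<^sub>G) x) G"
  by (rule inj_onI) (metis mult_gadd cancel)

lemma gadd_image: "x \<in> G \<Longrightarrow> (\<oplus>\<^sub>G) x ` G = G"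
  using endo_inj_surj[OF fin _ gadd_inj] gadd_closed by blast

end

text \<open>The functions in \<open>B\<close> play the role of coordinates; functions on \<open>G\<close> are extended by zero.\<close>

locale medial_quasigroup_functions = medial_quasigroup +
  fixes B :: "('a \<Rightarrow> complex) set"
  assumes finB: "finite B" and off: "b \<in> B \<Longrightarrow> x \<notin> G \<Longrightarrow> b x = 0"
    and transl: "b \<in> B \<Longrightarrow> a \<in> G \<Longrightarrow> (\<lambda>x. if x \<in> G then b (a \<star> x) else 0) \<in> fun_space.span B"
    and sepB: "x \<in> G \<Longrightarrow> y \<in> G \<Longrightarrow> x \<noteq> y \<Longrightarrow> \<exists>b\<in>B. b x \<noteq> b y"
begin

abbreviation U where "U \<equiv> fun_space.span B"

definition pullback :: "('a \<Rightarrow> 'a) \<Rightarrow> ('a \<Rightarrow> complex) \<Rightarrow> 'a \<Rightarrow> complex" where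
  "pullback r u = (\<lambda>x. if x \<in> G then u (r x) else 0)"

lemma U_off: "u \<in> U \<Longrightarrow> x \<notin> G \<Longrightarrow> u x = 0"
  by (induction rule: fun_space.span_induct_alt) (auto simp: off)

lemma pullback_mult: "u \<in> U \<Longrightarrow> a \<in> G \<Longrightarrow> pullback ((\<star>) a) u \<in> U"
proof (induction rule: fun_space.span_induct_alt)
  case base
  have *: "pullback ((\<star>) a) 0 = 0" by (auto simp: pullback_def fun_eq_iff)
  show ?case unfolding * by (rule fun_space.span_zero)
next
  case (step c b u)
  have "pullback ((\<star>) a) ((\<lambda>x. c * b x) + u) = (\<lambda>x. c * pullback ((\<star>) a) b x) + pullback ((\<star>) a) u"
    by (auto simp: pullback_def fun_eq_iff)
  moreover have "pullback ((\<star>) a) b \<in> U"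
    using transl[OF step(1) step.prems] unfolding pullback_def by simp
  ultimately show ?case
    using step by (simp only: fun_space.span_add fun_space.span_scale)
qed

lemma pullback_comp:
  assumes "\<And>u. u \<in> U \<Longrightarrow> pullback r u \<in> U" "\<And>u. u \<in> U \<Longrightarrow> pullback s u \<in> U"
    and "s ` G \<subseteq> G" "u \<in> U"
  shows "pullback (\<lambda>x. r (s x)) u \<in> U"
proof -
  have "pullback (\<lambda>x. r (s x)) u = pullback s (pullback r u)"
    using assms(3) by (auto simp: pullback_def fun_eq_iff)
  then show ?thesis using assms by simp
qed

lemma pullback_funpow:
  assumes "\<And>u. u \<in> U \<Longrightarrow> pullback r u \<in> U" "r ` G \<subseteq> G"
  shows "u \<in> U \<Longrightarrow> pullback (r ^^ k) u \<in> U"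
proof (induction k arbitrary: u)
  case 0
  have "pullback (r ^^ 0) u = u" using U_off[OF 0] by (auto simp: pullback_def fun_eq_iff)
  then show ?case using 0 by (simp add: id_def)
next
  case (Suc k)
  have "pullback (\<lambda>x. r ((r ^^ k) x)) u \<in> U"
    by (rule pullback_comp) (use assms Suc funpow_closed in auto)
  then show ?case by (simp add: comp_def)
qed

lemma pullback_double: "u \<in> U \<Longrightarrow> pullback double u \<in> U"
  unfolding double_def by (rule pullback_funpow) (use pullback_mult[OF _ e] mult_e_image in auto)

lemma pullback_gadd: "a \<in> G \<Longrightarrow> u \<in> U \<Longrightarrow> pullback ((\<oplus>\<^sub>G) a) u \<in> U"
  unfolding gadd_def[abs_def]
  by (rule pullback_comp) (use pullback_double pullback_mult closed in auto)

text \<open>Translations commute, so passing to a Fourier component under translation by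
  \<open>t\<close> keeps the eigenvalue relations already obtained for \<open>S\<close> and adds one
  for \<open>t\<close>. Some component still separates \<open>x\<close> and
  \<open>y\<close>.\<close>

lemma separating_eigenfunction:
  assumes xy: "x \<in> G" "y \<in> G" "x \<noteq> y" and S: "finite S" "S \<subseteq> G"
  shows "\<exists>u\<in>U. u x \<noteq> u y \<and> (\<forall>s\<in>S. \<exists>c. \<forall>v\<in>G. u (s \<oplus>\<^sub>G v) = c * u v)"
  using S
proof (induction S rule: finite_induct)
  case empty
  then show ?case using sepB[OF xy] fun_space.span_base by auto
next
  case (insert t S)
  then have t: "t \<in> G" by simp
  obtain u where u: "u \<in> U" "u x \<noteq> u y" "\<And>s. s \<in> S \<Longrightarrow> \<exists>c. \<forall>v\<in>G. u (s \<oplus>\<^sub>G v) = c * u v"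
    using insert by auto
  let ?r = "(\<oplus>\<^sub>G) t"
  have rG: "?r ` G \<subseteq> G" using gadd_image[OF t] by simp
  obtain q where q: "q > 0" "\<And>v. v \<in> G \<Longrightarrow> (?r ^^ q) v = v"
    using uniform_period[OF fin rG gadd_inj[OF t]] by metis
  obtain z where z: "z ^ q = 1" "(\<Sum>k<q. z ^ k * u ((?r ^^ k) x)) \<noteq> (\<Sum>k<q. z ^ k * u ((?r ^^ k) y))"
    using separating_fourier_component[OF q(1), of u x y ?r] u(2) by metis
  define p where "p = (\<Sum>k<q. (\<lambda>v. z ^ k * pullback (?r ^^ k) u v))"
  have p: "p v = (\<Sum>k<q. z ^ k * u ((?r ^^ k) v))" if "v \<in> G" for v
    using that by (simp add: p_def pullback_def sum_fun_apply)
  have "p \<in> U"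
    unfolding p_def
    by (intro fun_space.span_sum fun_space.span_scale pullback_funpow pullback_gadd t rG u)
  moreover have "p x \<noteq> p y" using z xy p by simp
  moreover have "\<exists>c. \<forall>v\<in>G. p (s \<oplus>\<^sub>G v) = c * p v" if s: "s \<in> insert t S" for s
  proof (cases "s \<in> S")
    case True
    then obtain c where c: "\<And>v. v \<in> G \<Longrightarrow> u (s \<oplus>\<^sub>G v) = c * u v" using u(3)[OF True] by blast
    have sG: "s \<in> G" using s insert.prems by auto
    have "(?r ^^ k) (s \<oplus>\<^sub>G v) = s \<oplus>\<^sub>G (?r ^^ k) v" if "v \<in> G" for k v
      using that funpow_closed[OF rG] by (induction k) (auto simp: gadd_left_commute t sG)
    then have "p (s \<oplus>\<^sub>G v) = c * p v" if "v \<in> G" for v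
      using that by (simp add: p gadd_closed sG c funpow_closed[OF rG] sum_distrib_left mult_ac)
    then show ?thesis by blast
  next
    case False
    then have st: "s = t" using s by simp
    have "z \<noteq> 0" using z(1) q(1) by (metis power_0_left less_irrefl_nat zero_neq_one)
    \<comment> \<open>Multiplying by \<open>z\<close> shifts the index of the cyclic sum, which
      closes up because \<open>z ^ q = 1\<close> and \<open>q\<close> is a period of the
      translation.\<close>
    have "z * p (t \<oplus>\<^sub>G v) = p v" if v: "v \<in> G" for v
    proof -
      have "z * p (t \<oplus>\<^sub>G v) = (\<Sum>k<q. z ^ Suc k * u ((?r ^^ Suc k) v))"
        by (simp add: p gadd_closed t v sum_distrib_left mult_ac funpow_swap1)
      also have "\<dots> = (\<Sum>k<Suc q. z ^ k * u ((?r ^^ k) v)) - u v"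
        unfolding sum.lessThan_Suc_shift by simp
      also have "\<dots> = p v" using z(1) q(2)[OF v] by (simp add: p v)
      finally show ?thesis .
    qed
    then have "\<forall>v\<in>G. p (s \<oplus>\<^sub>G v) = inverse z * p v"
      using \<open>z \<noteq> 0\<close> st by (metis mult.assoc left_inverse mult_1)
    then show ?thesis by blast
  qed
  ultimately show ?case by blast
qed

section \<open>Characters: separation, independence and squaring\<close>

definition characters :: "('a \<Rightarrow> complex) set" where
  "characters = {f \<in> U. f e = 1 \<and> (\<forall>x\<in>G. \<forall>y\<in>G. f (x \<oplus>\<^sub>G y) = f x * f y)}"

lemma character_nonzero:
  assumes f: "f \<in> characters" and x: "x \<in> G"
  shows "f x \<noteq> 0"
proof
  assume "f x = 0"
  obtain y where "y \<in> G" "x \<oplus>\<^sub>G y = e" using gadd_image[OF x] e by (metis imageE)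
  have "f (x \<oplus>\<^sub>G y) = f x * f y" using f x \<open>y \<in> G\<close> unfolding characters_def by blast
  then show False using f \<open>f x = 0\<close> \<open>x \<oplus>\<^sub>G y = e\<close> by (simp add: characters_def)
qed

text \<open>For a simultaneous eigenfunction \<open>u\<close> of all translations,
  \<open>u s\<close> is the eigenvalue of \<open>s\<close> times \<open>u e\<close>. So
  \<open>u e\<close> is nonzero, as \<open>u\<close> separates points, and dividing \<open>u\<close>
  by it gives a character.\<close>

lemma characters_separate:
  assumes xy: "x \<in> G" "y \<in> G" "x \<noteq> y"
  shows "\<exists>f\<in>characters. f x \<noteq> f y"
proof -
  obtain u where u: "u \<in> U" "u x \<noteq> u y" "\<And>s. s \<in> G \<Longrightarrow> \<exists>c. \<forall>v\<in>G. u (s \<oplus>\<^sub>G v) = c * u v"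
    using separating_eigenfunction[OF xy fin] by auto
  then obtain c where c: "\<And>s v. s \<in> G \<Longrightarrow> v \<in> G \<Longrightarrow> u (s \<oplus>\<^sub>G v) = c s * u v" by metis
  have ce: "u s = c s * u e" if "s \<in> G" for s
    using c[OF that e] gadd_e[OF that] by simp
  have "u e \<noteq> 0" using ce[OF xy(1)] ce[OF xy(2)] u(2) by auto
  define f where "f = (\<lambda>v. inverse (u e) * u v)"
  have "f \<in> characters"
    unfolding characters_def
  proof (intro CollectI conjI ballI)
    show "f \<in> U" unfolding f_def by (rule fun_space.span_scale[OF u(1)])
    show "f e = 1" using \<open>u e \<noteq> 0\<close> by (simp add: f_def)
    fix v w assume "v \<in> G" "w \<in> G"
    then show "f (v \<oplus>\<^sub>G w) = f v * f w"
      using \<open>u e \<noteq> 0\<close> by (simp add: f_def c ce[of v])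
  qed
  moreover have "f x \<noteq> f y" using u \<open>u e \<noteq> 0\<close> by (simp add: f_def)
  ultimately show ?thesis by blast
qed

text \<open>Translation by a point \<open>a\<close> with \<open>f a \<noteq> g a\<close> permutes
  \<open>G\<close> but multiplies the sum by \<open>f a / g a\<close>.\<close>

lemma character_orthogonality:
  assumes f: "f \<in> characters" and g: "g \<in> characters" and ne: "f \<noteq> g"
  shows "(\<Sum>x\<in>G. f x * inverse (g x)) = 0"
proof -
  \<comment> \<open>Both functions vanish off \<open>G\<close>, so they must differ on it.\<close>
  have "\<exists>a\<in>G. f a \<noteq> g a"
  proof (rule ccontr)
    assume "\<not> ?thesis"
    then have "f x = g x" for x
      using f g U_off[of f x] U_off[of g x] by (cases "x \<in> G") (auto simp: characters_def)
    then show False using ne by auto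
  qed
  then obtain a where a: "a \<in> G" "f a \<noteq> g a" by blast
  let ?s = "\<Sum>x\<in>G. f x * inverse (g x)"
  have "?s = (\<Sum>x\<in>G. f (a \<oplus>\<^sub>G x) * inverse (g (a \<oplus>\<^sub>G x)))"
    using sum.reindex[OF gadd_inj[OF a(1)], of "\<lambda>x. f x * inverse (g x)"] gadd_image[OF a(1)]
    by (simp add: comp_def)
  also have "\<dots> = f a * inverse (g a) * ?s"
    using f g a by (simp add: characters_def sum_distrib_left inverse_mult_distrib mult_ac)
  finally have "g a * ?s = f a * ?s"
    using character_nonzero[OF g a(1)] by (simp add: field_simps)
  then show ?thesis using a by simp
qed

text \<open>Summing a linear relation against \<open>inverse (g x)\<close> over \<open>G\<close>
  isolates the coefficient of \<open>g\<close>, times \<open>card G\<close>.\<close>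

lemma characters_independent: "fun_space.independent characters"
  unfolding fun_space.independent_explicit_module
proof (intro allI impI)
  fix T :: "('a \<Rightarrow> complex) set" and c g
  assume T: "finite T" "T \<subseteq> characters" and z: "(\<Sum>f\<in>T. (\<lambda>x. c f * f x)) = 0" and g: "g \<in> T"
  have "0 = (\<Sum>x\<in>G. (\<Sum>f\<in>T. (\<lambda>x. c f * f x)) x * inverse (g x))"
    by (simp add: z)
  also have "\<dots> = (\<Sum>x\<in>G. \<Sum>f\<in>T. c f * (f x * inverse (g x)))"
    by (simp add: sum_fun_apply sum_distrib_right mult.assoc)
  also have "\<dots> = (\<Sum>f\<in>T. c f * (\<Sum>x\<in>G. f x * inverse (g x)))"
    by (subst sum.swap) (simp add: sum_distrib_left)
  also have "\<dots> = (\<Sum>f\<in>T. if f = g then c g * of_nat (card G) else 0)"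
  proof (intro sum.cong refl)
    fix f assume "f \<in> T"
    moreover have "(\<Sum>x\<in>G. g x * inverse (g x)) = of_nat (card G)"
      using character_nonzero[of g] g T by (simp add: subset_eq)
    ultimately show "c f * (\<Sum>x\<in>G. f x * inverse (g x)) = (if f = g then c g * of_nat (card G) else 0)"
      using character_orthogonality[of f g] g T by auto
  qed
  also have "\<dots> = c g * of_nat (card G)" using g T by simp
  finally show "c g = 0" using fin e by auto
qed

lemma card_characters: "finite characters" "card characters \<le> card B"
  using fun_space.independent_span_bound[OF finB characters_independent]
  by (auto simp: characters_def)

lemma character_square:
  assumes f: "f \<in> characters" and x: "x \<in> G"
  shows "(f x)\<^sup>2 = f (double x)"
proof -
  have "f (x \<oplus>\<^sub>G x) = f x * f x" using f x unfolding characters_def by blast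
  then show ?thesis by (simp add: gadd_def idem[OF x] power2_eq_square)
qed

lemma square_character:
  assumes f: "f \<in> characters"
  shows "(\<lambda>x. (f x)\<^sup>2) \<in> characters"
proof -
  have "(\<lambda>x. (f x)\<^sup>2) = pullback double f"
    using character_square[OF f] U_off[of f] f by (auto simp: pullback_def fun_eq_iff characters_def)
  then have "(\<lambda>x. (f x)\<^sup>2) \<in> U" using pullback_double[of f] f by (simp add: characters_def)
  then show ?thesis using f by (auto simp: characters_def power_mult_distrib)
qed

text \<open>Squaring is pullback along \<open>double\<close>, which is onto \<open>G\<close>: every
  \<open>x\<close> in \<open>G\<close> is \<open>double (e \<star> x)\<close>.\<close>

lemma square_inj_on_characters: "inj_on (\<lambda>f x. (f x)\<^sup>2) characters"
proof (rule inj_onI)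
  fix f g assume fg: "f \<in> characters" "g \<in> characters" and eq: "(\<lambda>x. (f x)\<^sup>2) = (\<lambda>x. (g x)\<^sup>2)"
  have "f x = g x" for x
  proof (cases "x \<in> G")
    case True
    then show ?thesis
      using fun_cong[OF eq, of "e \<star> x"] fg character_square[of _ "e \<star> x"] closed[OF e True]
        double_mult[OF True] by simp
  qed (use fg U_off[of f x] U_off[of g x] in \<open>auto simp: characters_def\<close>)
  then show "f = g" by auto
qed

theorem injective_character:
  assumes n: "n \<ge> 2" "card B \<le> n" "card G = 2 ^ n - 1"
  obtains f :: "'a \<Rightarrow> complex" where "inj_on f G" "\<And>x. x \<in> G \<Longrightarrow> f x ^ (2 ^ n - 1) = 1"
    "\<And>x y. x \<in> G \<Longrightarrow> y \<in> G \<Longrightarrow> (f (x \<star> y))\<^sup>2 = f x * f y"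
proof -
  obtain f where f: "f \<in> characters" "inj_on f G" "\<And>x. x \<in> G \<Longrightarrow> f x ^ (2 ^ n - 1) = 1"
  proof (rule injective_root_of_unity_function[of characters G n])
    show "(\<lambda>f x. (f x)\<^sup>2) ` characters \<subseteq> characters" using square_character by auto
  qed (use card_characters square_inj_on_characters fin character_nonzero characters_separate n in auto)
  \<comment> \<open>In the group, \<open>x \<star> y\<close> is half of the sum of \<open>x\<close>
    and \<open>y\<close>, so squaring \<open>f\<close> there gives \<open>f\<close> at the
    sum.\<close>
  have "(f (x \<star> y))\<^sup>2 = f x * f y" if "x \<in> G" "y \<in> G" for x y
    using character_square[OF f(1) closed[OF that]] f(1) that by (auto simp: characters_def gadd_def)
  then show thesis using that[of f] f by blast
qed

end

section \<open>Generalized null spaces\<close>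

text \<open>Jordan blocks for the eigenvalue 0 have size at most \<open>n\<close>, so the
  \<open>k\<close>-th power annihilates them entirely, and their sizes add up to the algebraic
  multiplicity. Thus the spectrum determines this dimension.\<close>

lemma kernel_dim_pow_eq_order:
  fixes A :: "complex mat"
  assumes A: "A \<in> carrier_mat n n"
    and k: "n \<le> k"
  shows "kernel_dim (A ^\<^sub>m k) = Polynomial.order 0 (char_poly A)"
proof -
  obtain as where "char_poly A = (\<Prod>a\<leftarrow>as. [:- a, 1:])"
    using char_poly_factorized[OF A] by blast
  then obtain n_as where jnf: "jordan_nf A n_as"
    using jordan_nf_exists[OF A] by blast
  have "char_matrix A 0 = A"
    using A by (intro eq_matI) (auto simp: char_matrix_def)
  then have "kernel_dim (A ^\<^sub>m k) = (\<Sum>m\<leftarrow>map fst [(m, e)\<leftarrow>n_as. e = 0]. min k m)"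
    using dim_gen_eigenspace[OF jnf, of 0 k] by (simp add: dim_gen_eigenspace_def)
  also have "\<dots> = (\<Sum>m\<leftarrow>map fst [(m, e)\<leftarrow>n_as. e = 0]. m)"
  proof (intro arg_cong[of _ _ sum_list] map_cong refl)
    fix m assume "m \<in> set (map fst [(m, e)\<leftarrow>n_as. e = 0])"
    then have "m \<le> Polynomial.order 0 (char_poly A)"
      using jordan_nf_block_size_order_bound[OF jnf, of m 0] by auto
    also have "\<dots> \<le> n"
    proof -
      have "char_poly A \<noteq> 0" using degree_monic_char_poly[OF A] by auto
      from order_degree[OF this, of 0] show ?thesis using degree_monic_char_poly[OF A] by simp
    qed
    finally show "min k m = m" using k by simp
  qed
  also have "\<dots> = Polynomial.order 0 (char_poly A)"
    unfolding jordan_nf_order[OF jnf] by (simp add: case_prod_unfold)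
  finally show ?thesis .
qed

text \<open>A basis of the smaller kernel stays independent in the larger one and has enough
  elements to be a basis there.\<close>

lemma mat_kernel_eq_of_subset:
  fixes A B :: "'a :: field mat"
  assumes A: "A \<in> carrier_mat nr nc" and B: "B \<in> carrier_mat nr' nc"
    and dim: "kernel_dim A = kernel_dim B" and sub: "mat_kernel A \<subseteq> mat_kernel B"
  shows "mat_kernel A = mat_kernel B"
proof -
  interpret KA: kernel nr nc A by unfold_locales (rule A)
  interpret KB: kernel nr' nc B by unfold_locales (rule B)
  obtain S where S: "finite S" "KA.basis S"
    using kernel_basis_exists[OF A] by auto
  have SA: "S \<subseteq> mat_kernel A" "\<not> KA.lin_dep S" "KA.span S = mat_kernel A"
    using S(2) by (auto simp: KA.Ker.basis_def)
  have "KB.basis S"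
  proof (rule KB.Ker.dim_li_is_basis)
    show "KB.Ker.fin_dim" by (metis KB.Ker.fin_dim_def KB.Ker.basis_def kernel_basis_exists B)
    show "finite S" by (rule S)
    show "S \<subseteq> mat_kernel B" using SA sub by blast
    show "\<not> KB.lin_dep S"
      using SA sub KA.lindep_same[of S] KB.lindep_same[of S] by auto
    show "KB.dim \<le> card S"
      using KA.Ker.dim_basis[OF S] dim by simp
  qed
  then have "KB.span S = mat_kernel B" by (auto simp: KB.Ker.basis_def)
  then show ?thesis
    using SA sub KA.span_same[of S] KB.span_same[of S] by auto
qed

section \<open>Idempotents of medial isospectral algebras\<close>

lemma mult_unit_vec_eq_col:
  fixes M :: "'a :: semiring_1 mat"
  assumes "M \<in> carrier_mat m n" "j < n"
  shows "M *\<^sub>v unit_vec n j = col M j"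
  using assms by (intro eq_vecI) (auto simp: scalar_prod_right_unit)

lemma vec_diff_eq_zero_imp_eq:
  fixes x y :: "'a :: group_add vec"
  assumes "x \<in> carrier_vec n" "y \<in> carrier_vec n" "x - y = 0\<^sub>v n"
  shows "x = y"
proof (rule eq_vecI)
  fix i assume i: "i < dim_vec y"
  then have "(x - y) $ i = 0" using assms(2) by (simp add: assms(3))
  then show "x $ i = y $ i" using i by simp
qed (use assms in auto)

section \<open>The product and the multiplication operators in coordinates\<close>

lemma mul_carrier [simp]: "mul n C x y \<in> carrier_vec n"
  by (simp add: mul_def)

lemma Lmat_carrier [simp]: "Lmat n C c \<in> carrier_mat n n"
  by (simp add: Lmat_def)

lemma Lmat_mult_vec:
  assumes "x \<in> carrier_vec n"
  shows "Lmat n C c *\<^sub>v x = mul n C c x"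
proof (rule eq_vecI)
  fix k assume "k < dim_vec (mul n C c x)"
  then have k: "k < n" by (simp add: mul_def)
  have "(Lmat n C c *\<^sub>v x) $ k = (\<Sum>j<n. (\<Sum>i<n. c $ i * C i j k) * x $ j)"
    using k assms by (simp add: Lmat_def scalar_prod_def atLeast0LessThan)
  also have "\<dots> = (\<Sum>i<n. \<Sum>j<n. c $ i * x $ j * C i j k)"
    by (subst sum.swap) (simp add: sum_distrib_left sum_distrib_right mult_ac)
  finally show "(Lmat n C c *\<^sub>v x) $ k = mul n C c x $ k"
    using k by (simp add: mul_def)
qed (simp add: mul_def Lmat_def)

lemma mul_add_right:
  assumes "x \<in> carrier_vec n" "y \<in> carrier_vec n"
  shows "mul n C c (x + y) = mul n C c x + mul n C c y"
  using assms mult_add_distrib_mat_vec[OF Lmat_carrier assms] by (simp add: Lmat_mult_vec)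

lemma mul_diff_right:
  assumes "x \<in> carrier_vec n" "y \<in> carrier_vec n"
  shows "mul n C c (x - y) = mul n C c x - mul n C c y"
  using assms mult_minus_distrib_mat_vec[OF Lmat_carrier assms] by (simp add: Lmat_mult_vec)

lemma mul_zero_right: "mul n C c (0\<^sub>v n) = 0\<^sub>v n"
  by (intro eq_vecI) (auto simp: mul_def)

lemma mul_zero_left: "mul n C (0\<^sub>v n) c = 0\<^sub>v n"
  by (intro eq_vecI) (auto simp: mul_def)

lemma mul_commute:
  assumes "comm_struct K n C"
  shows "mul n C x y = mul n C y x"
proof (rule eq_vecI)
  fix k assume "k < dim_vec (mul n C y x)"
  then have k: "k < n" by (simp add: mul_def)
  have "(\<Sum>i<n. \<Sum>j<n. x $ i * y $ j * C i j k) = (\<Sum>i<n. \<Sum>j<n. y $ j * x $ i * C j i k)"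
    using assms k by (intro sum.cong refl) (simp add: comm_struct_def)
  also have "\<dots> = (\<Sum>i<n. \<Sum>j<n. y $ i * x $ j * C i j k)"
    by (rule sum.swap)
  finally show "mul n C x y $ k = mul n C y x $ k" using k by (simp add: mul_def)
qed (simp add: mul_def)

lemma Kvecs_mul:
  assumes "subfield_of_C K" "comm_struct K n C" "x \<in> Kvecs K n" "y \<in> Kvecs K n"
  shows "mul n C x y \<in> Kvecs K n"
proof -
  interpret subalgebra_of_C K K
    using assms(1) by (auto simp: subalgebra_of_C_def subfield_of_C_def)
  show ?thesis
    using assms by (auto simp: Kvecs_def mul_def comm_struct_def intro!: sum_closed mult_closed)
qed

lemma funpow_mul_carrier: "v \<in> carrier_vec n \<Longrightarrow> (mul n C c ^^ k) v \<in> carrier_vec n"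
  by (cases k) simp_all

lemma Lmat_pow_mult_vec:
  assumes v: "v \<in> carrier_vec n"
  shows "(Lmat n C c ^\<^sub>m k) *\<^sub>v v = (mul n C c ^^ k) v"
  using v
proof (induction k arbitrary: v)
  case 0
  then show ?case by (simp add: Lmat_def)
next
  case (Suc k)
  have "(Lmat n C c ^\<^sub>m Suc k) *\<^sub>v v = (Lmat n C c ^\<^sub>m k) *\<^sub>v (Lmat n C c *\<^sub>v v)"
    using assoc_mult_mat_vec[OF pow_carrier_mat[OF Lmat_carrier] Lmat_carrier Suc.prems, of C c k C c] by simp
  also have "\<dots> = (mul n C c ^^ Suc k) v"
    using Suc by (simp add: Lmat_mult_vec funpow_swap1)
  finally show ?case .
qed

text \<open>The exponent is left free so that inclusions need no bound on it;
  \<open>nil_space_eq_kernel\<close> shows that \<open>n\<close> suffices.\<close>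

definition nil_space :: "nat \<Rightarrow> (nat \<Rightarrow> nat \<Rightarrow> nat \<Rightarrow> complex) \<Rightarrow> complex vec \<Rightarrow> complex vec set" where
  "nil_space n C c = {v \<in> carrier_vec n. \<exists>k. (mul n C c ^^ k) v = 0\<^sub>v n}"

text \<open>The kernels of the powers increase, and from exponent \<open>n\<close> on their
  dimension is constant.\<close>

lemma nil_space_eq_kernel: "nil_space n C c = mat_kernel (Lmat n C c ^\<^sub>m n)"
proof -
  have ker: "mat_kernel (Lmat n C c ^\<^sub>m k) = {v \<in> carrier_vec n. (mul n C c ^^ k) v = 0\<^sub>v n}" for k
    by (auto simp: mat_kernel[OF pow_carrier_mat[OF Lmat_carrier]] Lmat_pow_mult_vec)
  have mono: "(mul n C c ^^ (j + k)) v = 0\<^sub>v n" if "(mul n C c ^^ k) v = 0\<^sub>v n" for j k v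
    using that by (induction j) (simp_all add: mul_zero_right)
  have stable: "mat_kernel (Lmat n C c ^\<^sub>m n) = mat_kernel (Lmat n C c ^\<^sub>m (k + n))" for k
  proof (rule mat_kernel_eq_of_subset)
    show "kernel_dim (Lmat n C c ^\<^sub>m n) = kernel_dim (Lmat n C c ^\<^sub>m (k + n))"
      using kernel_dim_pow_eq_order[OF Lmat_carrier[of n C c], of n]
        kernel_dim_pow_eq_order[OF Lmat_carrier[of n C c], of "k + n"] by simp
    show "mat_kernel (Lmat n C c ^\<^sub>m n) \<subseteq> mat_kernel (Lmat n C c ^\<^sub>m (k + n))"
      using mono[of n] by (auto simp: ker)
  qed (rule pow_carrier_mat[OF Lmat_carrier])+
  show ?thesis
  proof (intro equalityI subsetI)
    fix v assume v: "v \<in> nil_space n C c"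
    then obtain k where "(mul n C c ^^ k) v = 0\<^sub>v n" by (auto simp: nil_space_def)
    then have "(mul n C c ^^ (k + n)) v = 0\<^sub>v n" using mono[of k v n] by (simp add: add.commute)
    then have "v \<in> mat_kernel (Lmat n C c ^\<^sub>m (k + n))"
      unfolding ker using v by (simp add: nil_space_def)
    then show "v \<in> mat_kernel (Lmat n C c ^\<^sub>m n)" by (simp only: stable[of k])
  qed (auto simp: ker nil_space_def)
qed

section \<open>Null spaces and products of nonzero idempotents\<close>

locale medial_isospectral =
  fixes K :: "complex set" and n :: nat and C :: "nat \<Rightarrow> nat \<Rightarrow> nat \<Rightarrow> complex"
  assumes K: "subfield_of_C K" and C: "comm_struct K n C"
    and med: "medial K n C" and iso: "isospectral K n C"
begin

abbreviation mult (infixl "\<star>" 70) where "x \<star> y \<equiv> mul n C x y"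
abbreviation G where "G \<equiv> Idm K n C"
abbreviation N where "N \<equiv> nil_space n C"

lemma G_Kvecs: "c \<in> G \<Longrightarrow> c \<in> Kvecs K n" and G_idem: "c \<in> G \<Longrightarrow> c \<star> c = c"
  and G_carrier: "c \<in> G \<Longrightarrow> c \<in> carrier_vec n" and G_nonzero: "c \<in> G \<Longrightarrow> c \<noteq> 0\<^sub>v n"
  by (auto simp: Idm_def Kvecs_def)

lemma comm: "x \<star> y = y \<star> x"
  by (rule mul_commute[OF C])

lemma Kvecs_closed: "x \<in> Kvecs K n \<Longrightarrow> y \<in> Kvecs K n \<Longrightarrow> x \<star> y \<in> Kvecs K n"
  by (rule Kvecs_mul[OF K C])

text \<open>Mediality is assumed over \<open>K\<close> only, while null spaces consist of complex
  vectors. The last factor enters linearly, so it suffices to test unit vectors, that is, to compare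
  matrix columns.\<close>

lemma mediality:
  assumes "x \<in> Kvecs K n" "y \<in> Kvecs K n" "z \<in> Kvecs K n" and v: "v \<in> carrier_vec n"
  shows "(x \<star> y) \<star> (z \<star> v) = (x \<star> z) \<star> (y \<star> v)"
proof -
  have "Lmat n C (x \<star> y) * Lmat n C z = Lmat n C (x \<star> z) * Lmat n C y" (is "?A = ?B")
  proof (rule mat_col_eqI)
    fix j assume "j < dim_col ?B"
    then have j: "j < n" by (simp add: Lmat_def)
    have u: "unit_vec n j \<in> Kvecs K n"
      using K j by (auto simp: Kvecs_def subfield_of_C_def unit_vec_def)
    have "col (Lmat n C a * Lmat n C b) j = a \<star> (b \<star> unit_vec n j)" for a b
      using mult_unit_vec_eq_col[OF mult_carrier_mat[OF Lmat_carrier Lmat_carrier] j]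
      by (simp add: Lmat_mult_vec assoc_mult_mat_vec[OF Lmat_carrier Lmat_carrier] flip: mult_unit_vec_eq_col)
    then show "col ?A j = col ?B j"
      using med assms u by (simp add: medial_def)
  qed (simp_all add: Lmat_def)
  from arg_cong[OF this, of "\<lambda>M. M *\<^sub>v v"] show ?thesis
    using v by (simp add: assoc_mult_mat_vec[OF Lmat_carrier Lmat_carrier] Lmat_mult_vec)
qed

text \<open>Isospectrality gives 0 the same multiplicity in both spectra, hence the two null spaces
  have equal dimension.\<close>

lemma nil_space_eq_of_subset:
  assumes "c \<in> G" "d \<in> G" "N c \<subseteq> N d"
  shows "N c = N d"
proof -
  have "Polynomial.order 0 (char_poly (Lmat n C c)) = Polynomial.order 0 (char_poly (Lmat n C d))"
  proof -
    have "char_poly (Lmat n C x) \<noteq> 0" for x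
      using degree_monic_char_poly[OF Lmat_carrier[of n C x]] by auto
    then show ?thesis
      using iso assms unfolding isospectral_def spectrum_L_def by (metis count_proots)
  qed
  then have "kernel_dim (Lmat n C c ^\<^sub>m n) = kernel_dim (Lmat n C d ^\<^sub>m n)"
    by (simp add: kernel_dim_pow_eq_order[OF Lmat_carrier])
  then show ?thesis
    using assms(3) mat_kernel_eq_of_subset[OF pow_carrier_mat pow_carrier_mat, OF Lmat_carrier Lmat_carrier]
    unfolding nil_space_eq_kernel by blast
qed

text \<open>Mediality rewrites \<open>(c \<star> d) \<star> (y \<star> w)\<close> as
  \<open>(c \<star> y) \<star> (d \<star> w)\<close>, so each further factor
  \<open>c \<star> d\<close> yields a further factor \<open>d\<close> acting on the vector.\<close>

lemma nil_space_subset_mult: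
  assumes c: "c \<in> Kvecs K n" and d: "d \<in> Kvecs K n"
  shows "N d \<subseteq> N (c \<star> d)"
proof -
  \<comment> \<open>The witness \<open>y\<close> starts as \<open>c \<star> d\<close> and is
    multiplied by \<open>c\<close> at each step.\<close>
  have "\<exists>y\<in>Kvecs K n. \<forall>v\<in>carrier_vec n. (mul n C (c \<star> d) ^^ Suc j) v = y \<star> (mul n C d ^^ j) v" for j
  proof (induction j)
    case 0
    show ?case using c d Kvecs_closed by auto
  next
    case (Suc j)
    then obtain y where y: "y \<in> Kvecs K n"
      "\<And>v. v \<in> carrier_vec n \<Longrightarrow> (mul n C (c \<star> d) ^^ Suc j) v = y \<star> (mul n C d ^^ j) v" by blast
    have "(mul n C (c \<star> d) ^^ Suc (Suc j)) v = (c \<star> y) \<star> (mul n C d ^^ Suc j) v"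
      if v: "v \<in> carrier_vec n" for v
    proof -
      have "(mul n C (c \<star> d) ^^ Suc (Suc j)) v = (c \<star> d) \<star> (mul n C (c \<star> d) ^^ Suc j) v"
        by simp
      also have "\<dots> = (c \<star> d) \<star> (y \<star> (mul n C d ^^ j) v)" by (simp only: y(2)[OF v])
      also have "\<dots> = (c \<star> y) \<star> (d \<star> (mul n C d ^^ j) v)"
        by (rule mediality[OF c d y(1) funpow_mul_carrier[OF v]])
      finally show ?thesis by simp
    qed
    then show ?case using Kvecs_closed[OF c y(1)] by blast
  qed
  then show ?thesis
    unfolding nil_space_def using mul_zero_right by (auto; metis)
qed

lemma G_not_in_nil_space: "c \<in> G \<Longrightarrow> c \<notin> N c"
proof
  assume c: "c \<in> G" "c \<in> N c"
  have "(mul n C c ^^ k) c = c" for k by (induction k) (simp_all add: G_idem[OF c(1)])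
  then show False using c G_nonzero by (auto simp: nil_space_def)
qed

text \<open>Mediality gives \<open>c \<star> (d \<star> v) = (c \<star> d) \<star> (c \<star>
  v)\<close>, which is zero. Hence, after multiplication by \<open>c\<close>, powers of
  \<open>c + d\<close> act like powers of \<open>c\<close>.\<close>

lemma orthogonal_idempotents:
  assumes c: "c \<in> G" and d: "d \<in> G" and cd: "c \<star> d = 0\<^sub>v n"
  shows "c + d \<in> G" "N (c + d) \<subseteq> N c"
proof -
  note carr = G_carrier[OF c] G_carrier[OF d]
  have exp: "(c + d) \<star> v = c \<star> v + d \<star> v" if "v \<in> carrier_vec n" for v
    using mul_add_right[OF carr, of C v] by (simp add: comm[of _ v])
  have dc: "d \<star> c = 0\<^sub>v n" using cd comm by simp
  have csum: "c \<star> (c + d) = c" using carr by (simp add: mul_add_right G_idem[OF c] cd)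
  have "(c + d) \<star> (c + d) = c + d"
    using carr by (simp add: exp mul_add_right G_idem c d cd dc)
  moreover have "c + d \<noteq> 0\<^sub>v n"
    using csum G_nonzero[OF c] mul_zero_right[of n C c] by metis
  moreover have "c + d \<in> Kvecs K n"
    using G_Kvecs[OF c] G_Kvecs[OF d] K by (auto simp: Kvecs_def subfield_of_C_def)
  ultimately show "c + d \<in> G" by (simp add: Idm_def)
  have zero: "c \<star> (d \<star> v) = 0\<^sub>v n" if "v \<in> carrier_vec n" for v
    using mediality[OF G_Kvecs[OF c] G_Kvecs[OF c] G_Kvecs[OF d] that]
    by (simp add: G_idem[OF c] cd mul_zero_left)
  have step: "c \<star> ((c + d) \<star> v) = c \<star> (c \<star> v)" if "v \<in> carrier_vec n" for v
    using that by (simp add: exp mul_add_right zero)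
  have pow: "c \<star> (mul n C (c + d) ^^ k) v = (mul n C c ^^ Suc k) v" if "v \<in> carrier_vec n" for k v
  proof (induction k)
    case (Suc k)
    have "c \<star> (mul n C (c + d) ^^ Suc k) v = c \<star> (c \<star> (mul n C (c + d) ^^ k) v)"
      using step[OF funpow_mul_carrier[OF that]] by simp
    then show ?case using Suc by simp
  qed simp
  show "N (c + d) \<subseteq> N c"
  proof
    fix v assume v: "v \<in> N (c + d)"
    then obtain k where "v \<in> carrier_vec n" "(mul n C (c + d) ^^ k) v = 0\<^sub>v n"
      by (auto simp: nil_space_def)
    then show "v \<in> N c"
      using pow[of v k] unfolding nil_space_def by (metis (mono_tags) mem_Collect_eq mul_zero_right)
  qed
qed

lemma G_mult_nonzero:
  assumes c: "c \<in> G" and d: "d \<in> G"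
  shows "c \<star> d \<noteq> 0\<^sub>v n"
proof
  assume cd: "c \<star> d = 0\<^sub>v n"
  have "N (c + d) = N c" "N (d + c) = N d"
    using orthogonal_idempotents c d cd comm[of c d] nil_space_eq_of_subset by metis+
  then have "N c = N d" using comm_add_vec[OF G_carrier[OF c] G_carrier[OF d]] by simp
  moreover have "d \<in> N c"
    using G_carrier[OF d] cd by (auto simp: nil_space_def intro: exI[of _ 1])
  ultimately show False using G_not_in_nil_space[OF d] by simp
qed

lemma G_closed:
  assumes c: "c \<in> G" and d: "d \<in> G"
  shows "c \<star> d \<in> G"
proof -
  have "(c \<star> d) \<star> (c \<star> d) = c \<star> d"
    using mediality[OF G_Kvecs[OF c] G_Kvecs[OF d] G_Kvecs[OF c] G_carrier[OF d]]
    by (simp only: G_idem[OF c] G_idem[OF d])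
  then show ?thesis
    using G_mult_nonzero[OF assms] Kvecs_closed[OF G_Kvecs[OF c] G_Kvecs[OF d]]
    unfolding Idm_def by blast
qed

lemma nil_space_const:
  assumes c: "c \<in> G" and d: "d \<in> G"
  shows "N c = N d"
proof -
  have "N d = N (c \<star> d)" "N c = N (d \<star> c)"
    using assms by (metis nil_space_eq_of_subset G_closed nil_space_subset_mult G_Kvecs)+
  then show ?thesis using comm[of c d] by simp
qed

text \<open>Since \<open>d - e\<close> lies in \<open>N c = N d\<close>, iterating multiplication by
  \<open>d\<close> takes \<open>e\<close> to \<open>d\<close>. The last iterate \<open>f\<close>
  before \<open>d\<close> satisfies \<open>d \<star> f = d\<close>, so \<open>f - d\<close> lies in
  \<open>N d = N f\<close>; but multiplication by \<open>f\<close> fixes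
  \<open>f - d\<close>.\<close>

lemma G_cancel:
  assumes c: "c \<in> G" and d: "d \<in> G" and e: "e \<in> G" and eq: "c \<star> d = c \<star> e"
  shows "d = e"
proof (rule ccontr)
  assume ne: "d \<noteq> e"
  note carr = G_carrier[OF d] G_carrier[OF e]
  have "d - e \<in> N c"
    using carr eq by (auto simp: nil_space_def mul_diff_right intro!: exI[of _ 1])
  then obtain k where k: "(mul n C d ^^ k) (d - e) = 0\<^sub>v n"
    using nil_space_const[OF c d] by (auto simp: nil_space_def)
  have pow: "(mul n C d ^^ j) (d - e) = d - (mul n C d ^^ j) e" for j
    using carr by (induction j) (simp_all add: mul_diff_right funpow_mul_carrier G_idem[OF d])
  have "(mul n C d ^^ k) e = d"
  proof -
    have "d - (mul n C d ^^ k) e = 0\<^sub>v n" using k pow by simp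
    from vec_diff_eq_zero_imp_eq[OF carr(1) funpow_mul_carrier[OF carr(2)] this]
    show ?thesis by simp
  qed
  then obtain l where l: "(mul n C d ^^ l) e = d" "\<And>i. i < l \<Longrightarrow> (mul n C d ^^ i) e \<noteq> d"
    using exists_least_iff[of "\<lambda>l. (mul n C d ^^ l) e = d"] by blast
  have "l > 0" using l(1) ne by (cases l) auto
  define f where "f = (mul n C d ^^ (l - 1)) e"
  have "d \<star> f = d" using l(1) \<open>l > 0\<close> by (cases l) (simp_all add: f_def)
  have "f \<noteq> d" unfolding f_def using l(2)[of "l - 1"] \<open>l > 0\<close> by simp
  have "(mul n C d ^^ j) e \<in> G" for j by (induction j) (simp_all add: e G_closed[OF d])
  then have f: "f \<in> G" by (simp add: f_def)
  have "f - d \<in> N d"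
    using G_carrier[OF f] carr \<open>d \<star> f = d\<close>
    by (auto simp: nil_space_def mul_diff_right G_idem[OF d] intro!: exI[of _ 1])
  then obtain i where i: "(mul n C f ^^ i) (f - d) = 0\<^sub>v n"
    using nil_space_const[OF f d] by (auto simp: nil_space_def)
  have "(mul n C f ^^ j) (f - d) = f - d" for j
    using G_carrier[OF f] carr \<open>d \<star> f = d\<close>
    by (induction j) (simp_all add: mul_diff_right G_idem[OF f] comm[of f d])
  then have "f - d = 0\<^sub>v n" using i by simp
  then show False using \<open>f \<noteq> d\<close> G_carrier[OF f] carr vec_diff_eq_zero_imp_eq by blast
qed

end

context medial_isospectral
begin

definition coordinate :: "nat \<Rightarrow> complex vec \<Rightarrow> complex" where
  "coordinate i x = (if x \<in> G then x $ i else 0)"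

lemma quasigroup_functions:
  assumes fin: "finite G" and e: "e \<in> G"
  shows "medial_quasigroup_functions G (mul n C) e (coordinate ` {..<n})"
proof
  show "x \<star> x = x" if "x \<in> G" for x using that by (rule G_idem)
  show "x \<star> y = x \<star> z \<Longrightarrow> y = z" if "x \<in> G" "y \<in> G" "z \<in> G" for x y z
    using G_cancel[OF that] .
  show "(x \<star> y) \<star> (z \<star> w) = (x \<star> z) \<star> (y \<star> w)" if "x \<in> G" "y \<in> G" "z \<in> G" "w \<in> G" for x y z w
    using that by (intro mediality G_Kvecs G_carrier)
  show "\<exists>b\<in>coordinate ` {..<n}. b x \<noteq> b y" if "x \<in> G" "y \<in> G" "x \<noteq> y" for x y
  proof -
    have "\<exists>i<n. x $ i \<noteq> y $ i"
      using that G_carrier[of x] G_carrier[of y] eq_vecI[of x y] by auto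
    then show ?thesis using that by (auto simp: coordinate_def)
  qed
  show "(\<lambda>x. if x \<in> G then b (a \<star> x) else 0) \<in> fun_space.span (coordinate ` {..<n})"
    if "b \<in> coordinate ` {..<n}" "a \<in> G" for a b
  proof -
    from that obtain k where k: "k < n" "b = coordinate k" by auto
    \<comment> \<open>Coordinate \<open>k\<close> of \<open>a \<star> x\<close> is linear in the
      coordinates of \<open>x\<close>; its coefficients form row \<open>k\<close> of
      \<open>Lmat n C a\<close>.\<close>
    have "(\<lambda>x. if x \<in> G then b (a \<star> x) else 0)
        = (\<Sum>j<n. (\<lambda>x. (\<Sum>i<n. a $ i * C i j k) * coordinate j x))"
    proof
      fix x
      show "(if x \<in> G then b (a \<star> x) else 0)
          = (\<Sum>j<n. (\<lambda>x. (\<Sum>i<n. a $ i * C i j k) * coordinate j x)) x"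
      proof (cases "x \<in> G")
        case True
        have "b (a \<star> x) = (\<Sum>i<n. \<Sum>j<n. a $ i * x $ j * C i j k)"
          using G_closed[OF that(2) True] k by (simp add: coordinate_def) (simp add: mul_def)
        also have "\<dots> = (\<Sum>j<n. (\<Sum>i<n. a $ i * C i j k) * x $ j)"
          by (subst sum.swap) (simp add: sum_distrib_left sum_distrib_right mult_ac)
        finally show ?thesis using True by (simp add: sum_fun_apply coordinate_def)
      qed (simp add: sum_fun_apply coordinate_def)
    qed
    also have "\<dots> \<in> fun_space.span (coordinate ` {..<n})"
      by (intro fun_space.span_sum fun_space.span_scale fun_space.span_base) auto
    finally show ?thesis .
  qed
qed (use fin e comm G_closed in \<open>auto simp: coordinate_def\<close>)

end

section \<open>Counting idempotents and taking discrete logarithms\<close>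

lemma card_Idm:
  assumes "alg_closed_subfield K" "comm_struct K n C" "generic n C"
  shows "finite (Idm K n C)" "card (Idm K n C) = 2 ^ n - 1"
proof -
  let ?E = "{c \<in> carrier_vec n. mul n C c c = c}"
  have fin: "finite ?E" and card: "card ?E = 2 ^ n" using assms(3) by (auto simp: generic_def)
  \<comment> \<open>All complex idempotents have coordinates in \<open>K\<close>, so the complex
    count in \<open>generic\<close> carries over.\<close>
  have "Idm K n C = ?E - {0\<^sub>v n}"
    using idempotent_in_Kvecs[OF assms(1,2) fin] by (auto simp: Idm_def Kvecs_def)
  moreover have "0\<^sub>v n \<in> ?E" by (simp add: mul_zero_right)
  ultimately show "finite (Idm K n C)" "card (Idm K n C) = 2 ^ n - 1"
    using fin card by simp_all
qed

lemma half_mod_cong: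
  assumes "odd M" "M > 1"
  shows "[2 * half_mod M = 1] (mod M)"
proof -
  obtain b where b: "M = 2 * b + 1" using assms(1) by (rule oddE)
  then have "2 * (b + 1) - 1 = M" by simp
  \<comment> \<open>The number \<open>b + 1 = (M + 1) / 2\<close> shows that the choice in
    \<open>half_mod\<close> is from a nonempty set; \<open>M > 1\<close> puts it below
    \<open>M\<close>.\<close>
  then have "0 \<le> b + 1 \<and> b + 1 < M \<and> [2 * (b + 1) = 1] (mod M)"
    using assms(2) b unfolding cong_iff_dvd_diff by (simp add: add.commute)
  from someI[of "\<lambda>h. 0 \<le> h \<and> h < M \<and> [2 * h = 1] (mod M)", OF this]
  show ?thesis by (simp add: half_mod_def)
qed

text \<open>Powers of a primitive \<open>M\<close>-th root of unity depend only on the exponent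
  modulo \<open>M\<close> and are distinct for exponents below \<open>M\<close>.\<close>

lemma cis_root_eq_iff:
  assumes M: "M > 0"
  shows "cis (2 * pi * real i / real M) = cis (2 * pi * real j / real M) \<longleftrightarrow> [int i = int j] (mod int M)"
proof -
  define w where "w = cis (2 * pi / real M)"
  have wk: "cis (2 * pi * real k / real M) = w ^ k" for k
    by (simp add: w_def DeMoivre mult_ac)
  have "w ^ M = 1" using M by (simp flip: wk)
  have red: "w ^ k = w ^ (k mod M)" for k
  proof -
    have "w ^ k = w ^ (M * (k div M) + k mod M)" by simp
    also have "\<dots> = w ^ (k mod M)" unfolding power_add power_mult \<open>w ^ M = 1\<close> by simp
    finally show ?thesis .
  qed
  have "w ^ (i mod M) = w ^ (j mod M) \<longleftrightarrow> i mod M = j mod M"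
    using inj_on_eq_iff[OF bij_betw_imp_inj_on[OF bij_betw_roots_unity[OF M]], of "i mod M" "j mod M"] M
    by (simp add: wk)
  then show ?thesis
    unfolding wk using red[of i] red[of j] by (simp add: cong_def flip: of_nat_mod)
qed

theorem theorem2p6:
  fixes K :: "complex set" and n :: nat and C :: "nat \<Rightarrow> nat \<Rightarrow> nat \<Rightarrow> complex"
  assumes "alg_closed_subfield K"
    and "n \<ge> 2"
    and "comm_struct K n C"
    and "medial K n C"
    and "generic n C"
    and "isospectral K n C"
  shows "\<exists>\<phi>. bij_betw \<phi> (Idm K n C) {0..<2 ^ n - 1 :: int} \<and>
     (\<forall>x\<in>Idm K n C. \<forall>y\<in>Idm K n C. mul n C x y \<in> Idm K n C \<and>
        [\<phi> (mul n C x y) = half_mod (2 ^ n - 1) * (\<phi> x + \<phi> y)] (mod (2 ^ n - 1)))"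
proof -
  interpret medial_isospectral K n C
    using assms by unfold_locales (auto simp: alg_closed_subfield_def)
  define M :: nat where "M = 2 ^ n - 1"
  have "(2::nat) ^ n \<ge> 2 ^ 2" using assms(2) by (intro power_increasing) auto
  then have M: "M > 1" "int M = 2 ^ n - 1" by (auto simp: M_def of_nat_diff)
  have odd: "odd (int M)" using assms(2) by (simp add: M(2))
  have G: "finite G" "card G = M"
    using card_Idm[OF assms(1,3,5)] by (auto simp: M_def)
  then obtain e where e: "e \<in> G" using M by (metis card.empty ex_in_conv not_less0)
  interpret medial_quasigroup_functions G "mul n C" e "coordinate ` {..<n}"
    by (rule quasigroup_functions[OF G(1) e])
  have "card (coordinate ` {..<n}) \<le> n" using card_image_le[of "{..<n}" coordinate] by simp
  then obtain f :: "complex vec \<Rightarrow> complex" where f: "inj_on f G" "\<And>x. x \<in> G \<Longrightarrow> f x ^ M = 1"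
    "\<And>x y. x \<in> G \<Longrightarrow> y \<in> G \<Longrightarrow> (f (x \<star> y))\<^sup>2 = f x * f y"
    using injective_character[OF assms(2)] G(2) unfolding M_def by metis
  define r where "r k = cis (2 * pi * real k / real M)" for k
  have r: "bij_betw r {..<M} {z. z ^ M = 1}"
    using bij_betw_roots_unity[of M] M unfolding r_def by simp
  have r_mult: "r i * r j = r (i + j)" for i j
    by (simp add: r_def cis_mult add_divide_distrib distrib_left)
  have r_eq_iff: "r i = r j \<longleftrightarrow> [int i = int j] (mod int M)" for i j
    unfolding r_def by (rule cis_root_eq_iff) (use M in simp)
  \<comment> \<open>An injection of \<open>M\<close> points into the \<open>M\<close> roots of unity
    is onto.\<close>
  have "f ` G = {z. z ^ M = 1}"
  proof (rule card_subset_eq)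
    show "finite {z::complex. z ^ M = 1}" using M by (intro finite_roots_unity) auto
    show "card (f ` G) = card {z::complex. z ^ M = 1}"
      using G(2) card_image[OF f(1)] card_roots_unity_eq[of M] M by simp
  qed (use f(2) in auto)
  then have "bij_betw f G {z. z ^ M = 1}" using f(1) by (simp add: bij_betw_def)
  \<comment> \<open>The inverse of \<open>r\<close> is the discrete logarithm, so this composite is
    the sought bijection up to the cast to \<open>int\<close>.\<close>
  then have g: "bij_betw (inv_into {..<M} r \<circ> f) G {..<M}"
    using bij_betw_trans bij_betw_inv_into[OF r] by blast
  have rg: "r ((inv_into {..<M} r \<circ> f) x) = f x" if "x \<in> G" for x
    using that f(2) r by (simp add: bij_betw_inv_into_right)
  define \<phi> where "\<phi> x = int ((inv_into {..<M} r \<circ> f) x)" for x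
  have "bij_betw int {..<M} {0..<int M}"
    by (rule bij_betw_byWitness[where f' = nat]) auto
  then have "bij_betw \<phi> G {0..<2 ^ n - 1}"
    using bij_betw_trans[OF g] unfolding M(2)[symmetric] \<phi>_def[abs_def] comp_def by blast
  moreover have "[\<phi> (x \<star> y) = half_mod (2 ^ n - 1) * (\<phi> x + \<phi> y)] (mod (2 ^ n - 1))"
    if "x \<in> G" "y \<in> G" for x y
  proof -
    let ?h = "half_mod (int M)" and ?g = "inv_into {..<M} r \<circ> f"
    \<comment> \<open>In logarithms, the relation for the square of \<open>f (x \<star> y)\<close>
      says that twice the value at the product is the sum of the values; it remains to multiply by
      the inverse of 2.\<close>
    have "r (?g (x \<star> y) + ?g (x \<star> y)) = r (?g x + ?g y)"
      using f(3)[OF that] that G_closed[OF that] by (simp only: rg power2_eq_square flip: r_mult)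
    then have "[int (?g (x \<star> y) + ?g (x \<star> y)) = int (?g x + ?g y)] (mod int M)"
      by (simp only: r_eq_iff)
    then have 2: "[2 * \<phi> (x \<star> y) = \<phi> x + \<phi> y] (mod int M)"
      by (simp add: \<phi>_def)
    have h: "[2 * ?h = 1] (mod int M)" using half_mod_cong[OF odd] M(1) by simp
    have "[2 * ?h * \<phi> (x \<star> y) = 1 * \<phi> (x \<star> y)] (mod int M)"
      by (rule cong_mult[OF h cong_refl])
    moreover have "[?h * (2 * \<phi> (x \<star> y)) = ?h * (\<phi> x + \<phi> y)] (mod int M)"
      by (rule cong_mult[OF cong_refl 2])
    ultimately have "[\<phi> (x \<star> y) = ?h * (\<phi> x + \<phi> y)] (mod int M)"
      using cong_trans[OF cong_sym] by (simp add: mult_ac) blast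
    then show ?thesis by (simp only: M(2))
  qed
  ultimately show ?thesis using G_closed by blast
qed

end
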